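(* Let $M\subset\mathbb C^{N}$ be a generic real submanifold of class $\mathcal C^4$ and let $p\in M$. Assume that $M$ is fully non-degenerate at $p$. Then every element of $Aut(M,p)$ is uniquely determined by its jet of order two at $p$; that is, two elements of $Aut(M,p)$ with the same $2$-jet at $p$ coincide.
   Context: $Aut(M,p)$ denotes the set of germs at $p$ of biholomorphic maps $F$ of $\mathbb C^N$ fixing $p$ and such that $F(M)\subset M$. Let $d\ge 1$ be the real codimension of $M$ and $n=N-d$. After a local biholomorphic change of coordinates sending $p$ to $0$, a generic submanifold $M\subset\mathbb C^N=\mathbb C^n_z\times\mathbb C^d_w$ is given near $0$ by $$\mathrm{Re}\, w_j-{}^t\bar z A_j z+O(3)=0,\qquad j=1,\dots,d,$$ where $A_1,\dots,A_d$ are Hermitian $n\times n$ matrices, and in the remainder $O(3)$ (a function of $(z,\mathrm{Im}\,w)$) the variable $z$ has weight one and $\mathrm{Im}\, w$ has weight two. $M$ is called fully non-degenerate at $p$ if in such coordinates both conditions hold: (f) there exists $V\in\mathbb C^n$ such that $\mathrm{span}_{\mathbb C}\{A_1V,\dots,A_dV\}$ has dimension $d$; (t) there exists a real linear combination $\sum_{j=1}^d c_jA_j$ that is invertible. *)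

theory Defs
  imports "HOL-Analysis.Analysis" "HOL-Library.Landau_Symbols"
begin

section \<open>Iterated derivatives, jets and differentiability classes\<close>

primrec iterated_deriv ::
    "'a::real_normed_vector list \<Rightarrow> ('a \<Rightarrow> 'b::real_normed_vector) \<Rightarrow> 'a \<Rightarrow> 'b" where
  "iterated_deriv [] f = f"
| "iterated_deriv (v # vs) f = iterated_deriv vs (\<lambda>x. frechet_derivative f (at x) v)"

text \<open>The domain is finite dimensional and, in all uses, the set is open; directional derivatives
  along all lists of vectors then determine membership in the class of k times continuously
  differentiable maps.\<close>

definition class_C_on ::
    "nat \<Rightarrow> ('a::euclidean_space \<Rightarrow> 'b::real_normed_vector) \<Rightarrow> 'a set \<Rightarrow> bool" where
  "class_C_on k f S \<longleftrightarrow>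
     (\<forall>vs. length vs < k \<longrightarrow> (\<forall>x\<in>S. iterated_deriv vs f differentiable (at x))) \<and>
     (\<forall>vs. length vs \<le> k \<longrightarrow> continuous_on S (iterated_deriv vs f))"

definition same_jet ::
    "nat \<Rightarrow> ('a::euclidean_space \<Rightarrow> 'b::real_normed_vector) \<Rightarrow> ('a \<Rightarrow> 'b) \<Rightarrow> 'a \<Rightarrow> bool" where
  "same_jet k f g p \<longleftrightarrow>
     (\<forall>vs. length vs \<le> k \<longrightarrow> iterated_deriv vs f p = iterated_deriv vs g p)"

section \<open>Holomorphic maps in several variables\<close>

definition holomorphic_map_on :: "(complex^'m \<Rightarrow> complex^'k) \<Rightarrow> (complex^'m) set \<Rightarrow> bool" where
  "holomorphic_map_on F U \<longleftrightarrow>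
     (\<forall>x\<in>U. \<exists>L. Vector_Spaces.linear (*s) (*s) L \<and> (F has_derivative L) (at x))"

definition biholomorphic_between ::
    "(complex^'m \<Rightarrow> complex^'k) \<Rightarrow> (complex^'m) set \<Rightarrow> (complex^'k) set \<Rightarrow> bool" where
  "biholomorphic_between F U V \<longleftrightarrow>
     open U \<and> open V \<and> bij_betw F U V \<and>
     holomorphic_map_on F U \<and> holomorphic_map_on (inv_into U F) V"

section \<open>Generic submanifolds\<close>

text \<open>For a real function r, this is the (1,0)-form of r at x applied to v, that is, the sum over k
  of the Wirtinger derivatives of r with respect to the k-th coordinate, times the k-th component
  of v; equivalently, the complex linear part of the real differential dr.\<close>

definition del_form :: "(complex^'m \<Rightarrow> real) \<Rightarrow> complex^'m \<Rightarrow> complex^'m \<Rightarrow> complex" where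
  "del_form r x v =
     (of_real (frechet_derivative r (at x) v)
        - \<i> * of_real (frechet_derivative r (at x) (\<i> *s v))) / 2"

text \<open>Generic of class k and real codimension d: local defining functions whose (1,0)-forms
  are linearly independent over the complex numbers along M.\<close>

definition generic_submanifold :: "nat \<Rightarrow> nat \<Rightarrow> (complex^'m) set \<Rightarrow> bool" where
  "generic_submanifold k d M \<longleftrightarrow>
     (\<forall>q\<in>M. \<exists>U (r :: nat \<Rightarrow> complex^'m \<Rightarrow> real).
        open U \<and> q \<in> U \<and> (\<forall>j<d. class_C_on k (r j) U) \<and>
        M \<inter> U = {x \<in> U. \<forall>j<d. r j x = 0} \<and>
        (\<forall>x \<in> M \<inter> U. \<forall>c :: nat \<Rightarrow> complex.
           (\<forall>v. (\<Sum>j<d. c j * del_form (r j) x v) = 0) \<longrightarrow> (\<forall>j<d. c j = 0)))"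

text \<open>Germs are given by representatives: total functions whose values matter only near p.
  Two representatives define the same germ when they agree eventually in \<open>nhds p\<close>.\<close>

definition Aut_germs :: "(complex^'m) set \<Rightarrow> complex^'m \<Rightarrow> (complex^'m \<Rightarrow> complex^'m) set" where
  "Aut_germs M p =
     {F. F p = p \<and>
         (\<exists>U V. p \<in> U \<and> biholomorphic_between F U V \<and> F ` (M \<inter> U) \<subseteq> M)}"

section \<open>Full non-degeneracy\<close>

definition z_part :: "complex^('n::finite + 'd::finite) \<Rightarrow> complex^'n" where
  "z_part x = (\<chi> i. x $ Inl i)"

definition w_part :: "complex^('n::finite + 'd::finite) \<Rightarrow> complex^'d" where
  "w_part x = (\<chi> j. x $ Inr j)"

definition hermitian :: "complex^'n^'n \<Rightarrow> bool" where
  "hermitian A \<longleftrightarrow> (\<forall>i k. A $ i $ k = cnj (A $ k $ i))"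

definition herm_form :: "complex^'n^'n \<Rightarrow> complex^'n \<Rightarrow> complex" where
  "herm_form A z = (\<Sum>i\<in>UNIV. cnj (z $ i) * (A *v z) $ i)"

text \<open>Phi is a biholomorphic coordinate change near p with Phi(p) = 0 in which M is given by
  Re w_j - (conjugate transpose of z) A_j z + R_j(z, Im w) = 0. The remainder has the class k of
  the manifold and is O(3) in the weighted sense: z has weight 1 and Im w has weight 2, hence the
  square root.\<close>

definition normalizing_coordinates ::
    "nat \<Rightarrow> (complex^('n::finite + 'd::finite)) set \<Rightarrow> complex^('n + 'd)
      \<Rightarrow> (complex^('n + 'd) \<Rightarrow> complex^('n + 'd)) \<Rightarrow> ('d \<Rightarrow> complex^'n^'n) \<Rightarrow> bool" where
  "normalizing_coordinates k M p \<Phi> A \<longleftrightarrow>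
     (\<forall>j. hermitian (A j)) \<and> \<Phi> p = 0 \<and>
     (\<exists>U W S (R :: 'd \<Rightarrow> (complex^'n) \<times> (real^'d) \<Rightarrow> real).
        p \<in> U \<and> biholomorphic_between \<Phi> U W \<and>
        open S \<and> (\<forall>x\<in>W. (z_part x, \<chi> i. Im (w_part x $ i)) \<in> S) \<and>
        (\<forall>j. class_C_on k (R j) S) \<and>
        (\<forall>j. R j \<in> O[nhds 0](\<lambda>(z, v). (norm z + sqrt (norm v)) ^ 3)) \<and>
        \<Phi> ` (M \<inter> U) =
          {x \<in> W. \<forall>j. of_real (Re (w_part x $ j)) - herm_form (A j) (z_part x)
                        + of_real (R j (z_part x, \<chi> i. Im (w_part x $ i))) = 0})"

definition fully_nondegenerate ::
    "nat \<Rightarrow> (complex^('n::finite + 'd::finite)) set \<Rightarrow> complex^('n + 'd) \<Rightarrow> bool" where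
  "fully_nondegenerate k M p \<longleftrightarrow>
     (\<exists>\<Phi> (A :: 'd \<Rightarrow> complex^'n^'n). normalizing_coordinates k M p \<Phi> A \<and>
        (\<exists>V. vec.dim (vec.span (range (\<lambda>j. A j *v V))) = CARD('d)) \<and>
        (\<exists>c :: 'd \<Rightarrow> real. invertible (\<Sum>j\<in>UNIV. c j *\<^sub>R A j)))"

end

theory Submission
  imports Defs "HOL-Complex_Analysis.Conformal_Mappings"
begin

text \<open>If F and G have the same 2-jet, the inverse of G composed with F is, in normalizing coordinates, a
  holomorphic map y + h(y) preserving M, where h vanishes to order three. Suppose h is not zero
  and take its leading term for the dilations (t z, t^2 w). Rescaling M by these
  dilations turns it in the limit into the quadric Re w_j = z^* A_j z, and the leading term (f, g) of h
  into an infinitesimal automorphism of the quadric: Re g_j = 2 Re z^* A_j f along it.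

  On the quadric, polarize this identity and evaluate it at (s V, 2 s u), where u_j = \<omega>^* A_j V (for
  \<omega> = V these points form a stationary disc), against the partner with z-part conjugate to
  s / (s - 1) \<omega> + \<delta> / s, which stays bounded as s tends to infinity. This shows that \<delta>^* A_j f(s V, 2 s u)
  grows at most like s^2, while it vanishes to order s^3 at s = 0, so it is zero. Invertibility of
  a combination of the A_j gives f(V, 2 \<omega>^* A V) = 0, and the independence of the A_j V for one, hence
  for generic, V gives f = 0 and then g = 0.\<close>

section \<open>Taylor coefficients of functions of one variable\<close>

text \<open>The order of the jet enters at one place. The growth argument costs exactly s^2: one
  factor s from isolating \<delta> / s, the other from pairing with s V; vanishing to order s^3 is
  just enough to contradict it. M has only finitely many derivatives, so its remainders cannot be
  expanded in weighted homogeneous terms. They are removed by an estimate of increments instead: a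
  displacement of weights (a, a + 1) changes R by o(t^(a + 1)). This needs smallness of dR, which is
  deduced from the O(3) bound on the values of R and its second derivatives at 0. The leading term
  arises as a locally uniform limit of rescalings of h. It is therefore defined on the whole space
  and holomorphic along entire curves, although h is controlled only near 0; this makes Liouville's
  theorem available. A last obstacle is that germs are only assumed to map M into M, so that
  invariance of M under the inverse of G needs a topological argument.\<close>

lemma Cauchy_coeff_bound:
  assumes "f holomorphic_on ball 0 r" "r > 0" "\<And>t. norm t < r \<Longrightarrow> norm (f t) \<le> B"
  shows "norm ((deriv ^^ n) f 0 / fact n) \<le> B / r ^ n"
proof -
  have *: "norm ((deriv ^^ n) f 0 / fact n) \<le> B / \<rho> ^ n" if "0 < \<rho>" "\<rho> < r" for \<rho>
  proof -
    have "norm ((deriv ^^ n) f 0) \<le> fact n * B / \<rho> ^ n"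
    proof (rule Cauchy_inequality)
      show "f holomorphic_on ball 0 \<rho>"
        using assms(1) that by (auto intro: holomorphic_on_subset)
      show "continuous_on (cball 0 \<rho>) f"
        by (rule continuous_on_subset[OF holomorphic_on_imp_continuous_on[OF assms(1)]]) (use that in auto)
    qed (use that assms(3) in auto)
    then show ?thesis
      by (simp add: norm_divide field_simps)
  qed
  have "((\<lambda>\<rho>. B / \<rho> ^ n) \<longlongrightarrow> B / r ^ n) (at_left r)"
    using \<open>r > 0\<close> by (intro tendsto_intros) auto
  moreover have "\<forall>\<^sub>F \<rho> in at_left r. norm ((deriv ^^ n) f 0 / fact n) \<le> B / \<rho> ^ n"
    using eventually_at_left_real[OF \<open>r > 0\<close>] by eventually_elim (use * in auto)
  ultimately show ?thesis
    by (intro tendsto_lowerbound) auto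
qed

text \<open>The coefficients are at most B / r^i, so for norm t at most r / 2 the tail is at most
  twice its first term. The bound depends on f only through B and r, which later makes it uniform
  over families of curves.\<close>

lemma Taylor_remainder_bound:
  assumes hol: "f holomorphic_on ball 0 r" and "r > 0"
    and B: "\<And>t. norm t < r \<Longrightarrow> norm (f t) \<le> B" and t: "norm t \<le> r / 2"
  shows "norm (f t - (\<Sum>i<k. (deriv ^^ i) f 0 / fact i * t ^ i)) \<le> 2 * B * (norm t / r) ^ k"
proof -
  define a where "a i = (deriv ^^ i) f 0 / fact i * t ^ i" for i
  define q where "q = norm t / r"
  have q: "0 \<le> q" "q \<le> 1/2"
    using t \<open>r > 0\<close> by (auto simp: q_def field_simps)
  have "B \<ge> 0"
    using B[of 0] \<open>r > 0\<close> norm_ge_zero order_trans by (metis norm_zero)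
  have sums: "a sums f t"
    using holomorphic_power_series[OF hol, of t] t \<open>r > 0\<close> by (simp add: a_def[abs_def])
  have le: "norm (a i) \<le> B * q ^ i" for i
  proof -
    have "norm (a i) \<le> B / r ^ i * norm t ^ i"
      unfolding a_def norm_mult norm_power
      by (intro mult_right_mono Cauchy_coeff_bound assms) auto
    then show ?thesis by (simp add: q_def power_divide)
  qed
  have s: "(\<lambda>i. a (i + k)) sums (f t - (\<Sum>i<k. a i))"
    using sums by (rule sums_split_initial_segment)
  have g: "(\<lambda>i. B * q ^ k * q ^ i) sums (B * q ^ k * (1 / (1 - q)))"
    using q by (intro sums_mult geometric_sums) auto
  have "norm (\<Sum>i. a (i + k)) \<le> (\<Sum>i. B * q ^ k * q ^ i)"
  proof (rule norm_suminf_le)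
    show "norm (a (i + k)) \<le> B * q ^ k * q ^ i" for i
      using le[of "i + k"] by (simp add: power_add mult_ac)
  qed (use g in \<open>simp add: sums_iff\<close>)
  then have "norm (f t - (\<Sum>i<k. a i)) \<le> B * q ^ k * (1 / (1 - q))"
    using s g by (simp add: sums_iff)
  also have "\<dots> \<le> B * q ^ k * 2"
    using q \<open>B \<ge> 0\<close> by (intro mult_left_mono) (auto simp: field_simps)
  finally show ?thesis
    by (simp add: a_def q_def mult_ac)
qed

text \<open>Cauchy's estimate on the disc of radius \<rho> bounds the coefficient by C \<rho>^(k -
  i), which tends to 0 with \<rho>.\<close>

lemma Taylor_coeff_eq_0:
  assumes "f holomorphic_on ball 0 r" "r > 0"
    and B: "\<And>t. norm t < r \<Longrightarrow> norm (f t) \<le> C * norm t ^ k" and "i < k"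
  shows "(deriv ^^ i) f 0 = 0"
proof -
  have "0 < (r / 2) ^ k"
    using \<open>r > 0\<close> by simp
  moreover have "0 \<le> C * (r / 2) ^ k"
    using order_trans[OF norm_ge_zero B[of "of_real (r/2)"]] \<open>r > 0\<close> by simp
  ultimately have "C \<ge> 0"
    by (meson linorder_not_less mult_neg_pos)
  have *: "norm ((deriv ^^ i) f 0 / fact i) \<le> C * \<rho> ^ (k - i)" if "0 < \<rho>" "\<rho> < r" for \<rho>
  proof -
    have "norm ((deriv ^^ i) f 0 / fact i) \<le> C * \<rho> ^ k / \<rho> ^ i"
    proof (rule Cauchy_coeff_bound)
      show "f holomorphic_on ball 0 \<rho>"
        using assms(1) that by (auto intro: holomorphic_on_subset)
      fix t :: complex assume "norm t < \<rho>"
      then show "norm (f t) \<le> C * \<rho> ^ k"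
        using B[of t] that \<open>C \<ge> 0\<close> by (smt (verit) mult_left_mono norm_ge_zero power_mono)
    qed (use that in auto)
    also have "\<dots> = C * \<rho> ^ (k - i)"
      using that \<open>i < k\<close> by (simp add: power_diff)
    finally show ?thesis .
  qed
  have "((\<lambda>\<rho>. C * \<rho> ^ (k - i)) \<longlongrightarrow> C * 0 ^ (k - i)) (at_right 0)"
    by (intro tendsto_intros)
  moreover have "\<forall>\<^sub>F \<rho> in at_right 0. norm ((deriv ^^ i) f 0 / fact i) \<le> C * \<rho> ^ (k - i)"
    using eventually_at_right_real[OF \<open>r > 0\<close>] by eventually_elim (use * in auto)
  ultimately have "norm ((deriv ^^ i) f 0 / fact i) \<le> C * 0 ^ (k - i)"
    by (intro tendsto_lowerbound) auto
  then show ?thesis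
    using \<open>i < k\<close> by (simp add: power_0_left)
qed

text \<open>By Liouville, growth of degree n leaves a polynomial of degree at most n; contact of
  order n + 1 at 0 removes all its coefficients. It is applied with n = 2.\<close>

lemma entire_growth_eq_0:
  assumes "f holomorphic_on UNIV"
    and "\<And>s. norm s \<ge> R \<Longrightarrow> norm (f s) \<le> C * norm s ^ n"
    and "r > 0" "\<And>s. norm s < r \<Longrightarrow> norm (f s) \<le> D * norm s ^ Suc n"
  shows "f s = 0"
proof -
  have "(deriv ^^ i) f 0 = 0" if "i \<le> n" for i
    using assms(1,3,4) that
    by (intro Taylor_coeff_eq_0[where r = r and C = D and k = "Suc n"])
       (auto intro: holomorphic_on_subset)
  then show ?thesis
    using Liouville_polynomial[OF assms(1,2), where \<xi> = s] by simp
qed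

lemma entire_eq_0_if_eq_0_on_reals:
  assumes "f holomorphic_on UNIV" "\<And>x. f (of_real x) = 0"
  shows "f s = 0"
proof (rule analytic_continuation[of f UNIV \<real> 0])
  show "0 islimpt (\<real> :: complex set)"
    unfolding islimpt_approachable
  proof safe
    fix e :: real assume "e > 0"
    then show "\<exists>x'\<in>\<real>. x' \<noteq> (0::complex) \<and> dist x' 0 < e"
      by (intro bexI[of _ "of_real (e/2)"]) auto
  qed
qed (use assms in \<open>auto elim: Reals_cases\<close>)

lemma entire_eq_0_if_eventually_0:
  assumes "f holomorphic_on UNIV" "\<forall>\<^sub>F s in nhds 0. f s = 0"
  shows "f s = 0"
proof -
  obtain S where "open S" "0 \<in> S" "\<And>s. s \<in> S \<Longrightarrow> f s = 0"
    using assms(2) unfolding eventually_nhds by blast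
  then show ?thesis
    by (intro analytic_continuation_open[of S UNIV f "\<lambda>_. 0" s, simplified]) (use assms(1) in auto)
qed

section \<open>Holomorphic functions of several variables\<close>

text \<open>The real derivative is additive already, so commuting with complex scalars makes it
  complex linear: these are the Cauchy-Riemann equations for scalar functions.\<close>

definition holo :: "(complex^'m \<Rightarrow> complex) \<Rightarrow> (complex^'m) set \<Rightarrow> bool" where
  "holo h U \<longleftrightarrow> (\<forall>x\<in>U. \<exists>L. (h has_derivative L) (at x) \<and> (\<forall>c v. L (c *s v) = c * L v))"

lemma holo_subset: "holo h U \<Longrightarrow> V \<subseteq> U \<Longrightarrow> holo h V"
  by (auto simp: holo_def)

lemma holo_continuous_on: "holo h U \<Longrightarrow> continuous_on U h"
  unfolding holo_def
  by (meson continuous_at_imp_continuous_on has_derivative_continuous)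

lemma bounded_linear_axis: "bounded_linear (axis i :: complex \<Rightarrow> complex^'m)"
  unfolding linear_conv_bounded_linear[symmetric]
  by (rule linearI) (auto simp: vec_eq_iff axis_def)

text \<open>The bridge to one variable: Cauchy estimates, Taylor expansions and the identity theorem
  are all applied to restrictions of h to curves.\<close>

lemma holo_comp_curve:
  fixes \<gamma> :: "complex \<Rightarrow> complex^'m"
  assumes h: "holo h U" and \<gamma>: "\<And>i. (\<lambda>s. \<gamma> s $ i) holomorphic_on T" and "open T"
    and sub: "\<And>s. s \<in> T \<Longrightarrow> \<gamma> s \<in> U"
  shows "(\<lambda>s. h (\<gamma> s)) holomorphic_on T"
  unfolding holomorphic_on_open[OF \<open>open T\<close>]
proof
  fix s assume s: "s \<in> T"
  have "\<forall>i. \<exists>d. ((\<lambda>s. \<gamma> s $ i) has_field_derivative d) (at s)"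
    using \<gamma> s \<open>open T\<close> by (auto simp: holomorphic_on_open)
  then obtain d where d: "\<And>i. ((\<lambda>s. \<gamma> s $ i) has_field_derivative d i) (at s)"
    by metis
  have eq: "(\<lambda>s. \<Sum>i\<in>UNIV. axis i (\<gamma> s $ i)) = \<gamma>"
    by (auto simp: vec_eq_iff axis_def if_distrib cong: if_cong)
  have "((\<lambda>s. \<Sum>i\<in>UNIV. axis i (\<gamma> s $ i)) has_derivative (\<lambda>c. \<Sum>i\<in>UNIV. axis i (d i * c))) (at s)"
    by (intro has_derivative_sum bounded_linear.has_derivative[OF bounded_linear_axis])
       (use d in \<open>auto simp: has_field_derivative_def\<close>)
  then have 1: "(\<gamma> has_derivative (\<lambda>c. c *s (\<chi> i. d i))) (at s)"
    unfolding eq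
    by (rule has_derivative_eq_rhs) (auto simp: vec_eq_iff axis_def if_distrib mult_ac cong: if_cong)
  obtain L where L: "(h has_derivative L) (at (\<gamma> s))" "\<And>c v. L (c *s v) = c * L v"
    using h sub[OF s] by (auto simp: holo_def)
  have "((\<lambda>s. h (\<gamma> s)) has_derivative (\<lambda>c. L (c *s (\<chi> i. d i)))) (at s)"
    using has_derivative_compose[OF 1 L(1)] .
  then have "((\<lambda>s. h (\<gamma> s)) has_field_derivative L (\<chi> i. d i)) (at s)"
    unfolding has_field_derivative_def L(2) by (simp add: mult_commute_abs)
  then show "\<exists>f'. ((\<lambda>s. h (\<gamma> s)) has_field_derivative f') (at s)" ..
qed

lemma norm_smult_cart: "norm (c *s v) = norm c * norm v" for v :: "complex^'m"
  by (simp add: norm_vec_def norm_mult L2_set_right_distrib)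

lemma frechet_holo:
  assumes "holo h U" "x \<in> U"
  shows "(h has_derivative frechet_derivative h (at x)) (at x)"
    and "frechet_derivative h (at x) (c *s v) = c * frechet_derivative h (at x) v"
proof -
  obtain L where L: "(h has_derivative L) (at x)" "\<And>c v. L (c *s v) = c * L v"
    using assms by (auto simp: holo_def)
  moreover have "frechet_derivative h (at x) = L"
    using frechet_derivative_at[OF L(1)] by simp
  ultimately show "(h has_derivative frechet_derivative h (at x)) (at x)"
    and "frechet_derivative h (at x) (c *s v) = c * frechet_derivative h (at x) v"
    by auto
qed

lemma has_derivative_complex_line: "((\<lambda>t. x + t *s v) has_derivative (\<lambda>t. t *s v)) (at t)"
  for x v :: "complex^'m"
proof -
  have "linear (\<lambda>t. t *s v)"
    by (rule linearI) (auto simp: vec_eq_iff algebra_simps)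
  then show ?thesis
    by (auto intro!: derivative_eq_intros bounded_linear_imp_has_derivative
        simp: linear_conv_bounded_linear)
qed

lemma holo_line_has_field_derivative:
  assumes "holo h U" "x + t *s v \<in> U"
  shows "((\<lambda>t. h (x + t *s v)) has_field_derivative frechet_derivative h (at (x + t *s v)) v) (at t)"
proof -
  from has_derivative_compose[OF has_derivative_complex_line frechet_holo(1)[OF assms]]
  show ?thesis
    by (simp add: has_field_derivative_def frechet_holo(2)[OF assms] mult_commute_abs)
qed

lemma holo_line:
  assumes "holo h U" "\<And>t. norm t < r \<Longrightarrow> x + t *s v \<in> U"
  shows "(\<lambda>t. h (x + t *s v)) holomorphic_on ball 0 r"
  using assms(2) by (intro holo_comp_curve[OF assms(1)]) (auto intro!: holomorphic_intros)

lemma holo_locally_bounded: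
  assumes "holo h U" "open U" "a \<in> U"
  obtains r B where "r > 0" "ball a r \<subseteq> U" "\<And>x. x \<in> ball a r \<Longrightarrow> norm (h x) \<le> B"
proof -
  have "continuous (at a) h"
    using holo_continuous_on[OF assms(1)] assms(2,3) by (simp add: continuous_on_eq_continuous_at)
  then obtain d where d: "d > 0" "\<And>x. dist x a < d \<Longrightarrow> dist (h x) (h a) < 1"
    unfolding continuous_at_eps_delta using zero_less_one by blast
  obtain e where "e > 0" "ball a e \<subseteq> U"
    using assms(2,3) open_contains_ball by blast
  then show ?thesis
  proof (intro that[of "min d e" "norm (h a) + 1"])
    fix x assume "x \<in> ball a (min d e)"
    then have "dist (h x) (h a) < 1"
      by (intro d(2)) (simp add: dist_commute)
    then show "norm (h x) \<le> norm (h a) + 1"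
      using norm_triangle_sub[of "h x" "h a"] by (simp add: dist_norm)
  qed (use d in auto)
qed

lemma holo_diff: "holo f U \<Longrightarrow> holo g U \<Longrightarrow> holo (\<lambda>x. f x - g x) U"
  unfolding holo_def
proof safe
  fix x assume "x \<in> U" "\<forall>x\<in>U. \<exists>L. (f has_derivative L) (at x) \<and> (\<forall>c v. L (c *s v) = c * L v)"
    "\<forall>x\<in>U. \<exists>L. (g has_derivative L) (at x) \<and> (\<forall>c v. L (c *s v) = c * L v)"
  then obtain L K where "(f has_derivative L) (at x)" "\<And>c v. L (c *s v) = c * L v"
    "(g has_derivative K) (at x)" "\<And>c v. K (c *s v) = c * K v"
    by meson
  then show "\<exists>L. ((\<lambda>x. f x - g x) has_derivative L) (at x) \<and> (\<forall>c v. L (c *s v) = c * L v)"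
    by (intro exI[of _ "\<lambda>v. L v - K v"]) (auto intro!: derivative_intros simp: algebra_simps)
qed

lemma holo_cmult: "holo f U \<Longrightarrow> holo (\<lambda>x. c * f x) U"
  unfolding holo_def
proof safe
  fix x assume "x \<in> U" "\<forall>x\<in>U. \<exists>L. (f has_derivative L) (at x) \<and> (\<forall>c v. L (c *s v) = c * L v)"
  then obtain L where "(f has_derivative L) (at x)" "\<And>c v. L (c *s v) = c * L v"
    by meson
  then show "\<exists>L. ((\<lambda>x. c * f x) has_derivative L) (at x) \<and> (\<forall>c v. L (c *s v) = c * L v)"
    by (intro exI[of _ "\<lambda>v. c * L v"]) (auto intro!: derivative_eq_intros simp: algebra_simps)
qed

lemma holo_translate:
  assumes "holo f U" "\<And>x. x \<in> V \<Longrightarrow> x + a \<in> U"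
  shows "holo (\<lambda>x. f (x + a)) V"
  unfolding holo_def
proof
  fix x assume "x \<in> V"
  then obtain L where L: "(f has_derivative L) (at (x + a))" "\<And>c v. L (c *s v) = c * L v"
    using assms unfolding holo_def by meson
  have "((\<lambda>x. x + a) has_derivative (\<lambda>v. v)) (at x)"
    by (auto intro!: derivative_eq_intros)
  from has_derivative_compose[OF this L(1)] L(2)
  show "\<exists>L. ((\<lambda>x. f (x + a)) has_derivative L) (at x) \<and> (\<forall>c v. L (c *s v) = c * L v)"
    by (intro exI[of _ L]) auto
qed

text \<open>The derivative in direction u is the first Taylor coefficient on the line a + t u, which
  stays in the ball for norm t < r / norm u.\<close>

lemma frechet_holo_bound:
  assumes "holo h (ball a r)" "r > 0" "\<And>x. x \<in> ball a r \<Longrightarrow> norm (h x) \<le> B"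
  shows "norm (frechet_derivative h (at a) u) \<le> B / r * norm u"
proof (cases "u = 0")
  case True
  have "linear (frechet_derivative h (at a))"
    using frechet_holo(1)[OF assms(1), of a] assms(2) by (auto intro: has_derivative_linear)
  then show ?thesis
    using True by (simp add: linear_0)
next
  case False
  have b: "a + t *s u \<in> ball a r" if "norm t < r / norm u" for t
    using that False by (simp add: dist_norm norm_smult_cart field_simps)
  have "norm ((deriv ^^ 1) (\<lambda>t. h (a + t *s u)) 0 / fact 1) \<le> B / (r / norm u) ^ 1"
    using b assms False by (intro Cauchy_coeff_bound holo_line[OF assms(1)]) auto
  then show ?thesis
    using DERIV_imp_deriv[OF holo_line_has_field_derivative[OF assms(1), of a 0 u]] \<open>r > 0\<close>
    by simp
qed

text \<open>On the complex line from y through x the points with norm t < 4 r / norm (x - y) stay in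
  the ball of radius 5 r. As norm (x - y) < 2 r, the value t = 1 lies in the inner half of this
  disc, and the Taylor remainder of order one there is the increment.\<close>

lemma holo_Lipschitz:
  assumes h: "holo h (ball a (5 * r))" and "r > 0"
    and B: "\<And>x. x \<in> ball a (5 * r) \<Longrightarrow> norm (h x) \<le> B" and xy: "x \<in> ball a r" "y \<in> ball a r"
  shows "norm (h x - h y) \<le> B / r * norm (x - y)"
proof -
  have B0: "B \<ge> 0"
    using B[of a] \<open>r > 0\<close> by (smt (verit) centre_in_ball norm_ge_zero)
  show ?thesis
  proof (cases "x = y")
    case False
    have n: "norm (x - y) < 2 * r"
      using xy norm_triangle_ineq4[of "x - a" "y - a"] by (simp add: dist_norm norm_minus_commute)
    then have 2: "4 * r / norm (x - y) \<ge> 2"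
      using False by (simp add: field_simps)
    have b: "y + t *s (x - y) \<in> ball a (5 * r)" if "norm t < 4 * r / norm (x - y)" for t
    proof -
      have "norm (t *s (x - y)) < 4 * r"
        unfolding norm_smult_cart using that False by (simp add: field_simps)
      then have "norm ((y - a) + t *s (x - y)) < 5 * r"
        using xy norm_triangle_ineq[of "y - a" "t *s (x - y)"]
        by (simp add: dist_norm norm_minus_commute)
      then show ?thesis
        by (simp add: dist_norm norm_minus_commute algebra_simps)
    qed
    have "norm (h (y + 1 *s (x - y)) - (\<Sum>i<1. (deriv ^^ i) (\<lambda>t. h (y + t *s (x - y))) 0 / fact i * 1 ^ i))
        \<le> 2 * B * (norm (1::complex) / (4 * r / norm (x - y))) ^ 1"
      using b B 2 n \<open>r > 0\<close> False by (intro Taylor_remainder_bound holo_line[OF h]) auto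
    also have "\<dots> \<le> B / r * norm (x - y)"
      using B0 \<open>r > 0\<close> by (simp add: field_simps)
    finally show ?thesis by simp
  qed simp
qed

text \<open>The difference quotients along v converge uniformly, so by Cauchy's estimate their derivatives do
  as well.\<close>

lemma holo_directional_derivative_differentiable:
  assumes "holo h U" "open U" "a \<in> U"
  shows "(\<lambda>x. frechet_derivative h (at x) v) differentiable (at a)"
proof -
  obtain R B where R: "R > 0" "ball a R \<subseteq> U" and B: "\<And>x. x \<in> ball a R \<Longrightarrow> norm (h x) \<le> B"
    using holo_locally_bounded[OF assms] by metis
  have h: "holo h (ball a R)"
    using holo_subset[OF assms(1) R(2)] .
  define D where "D x u = frechet_derivative h (at x) u" for x u
  \<comment> \<open>With this radius x + t v remains in the ball of radius R for x in the half ball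
    and norm t < \<rho>; the summand 1 covers v = 0.\<close>
  define \<rho> where "\<rho> = R / (2 * (norm v + 1))"
  have \<rho>: "\<rho> > 0" "\<rho> * norm v \<le> R / 2"
    using \<open>R > 0\<close> by (auto simp: \<rho>_def field_simps add_pos_nonneg)
  define \<tau> where "\<tau> n = \<rho> / 2 / real (Suc n)" for n
  have \<tau>: "0 < \<tau> n" "\<tau> n \<le> \<rho> / 2" for n
    using \<rho>(1) by (auto simp: \<tau>_def field_simps)
  have \<tau>0: "\<tau> \<longlonglongrightarrow> 0"
    unfolding \<tau>_def[abs_def] by (intro real_tendsto_divide_at_top[OF tendsto_const] filterlim_real_sequentially
        filterlim_compose[OF filterlim_real_sequentially filterlim_Suc])
  have sub: "x + t *s v \<in> ball a R" if "x \<in> ball a (R / 2)" "norm t < \<rho>" for x t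
  proof -
    have "norm (t *s v) \<le> R / 2"
      using that \<rho> mult_right_mono[of "norm t" \<rho> "norm v"] by (simp add: norm_smult_cart)
    then have "norm ((x - a) + t *s v) < R"
      using that norm_triangle_ineq[of "x - a" "t *s v"] by (simp add: dist_norm norm_minus_commute)
    then show ?thesis by (simp add: dist_norm norm_minus_commute algebra_simps)
  qed
  define f where "f n x = (1 / of_real (\<tau> n)) * (h (x + of_real (\<tau> n) *s v) - h x)" for n x
  \<comment> \<open>The quotient differs from the derivative by a second-order Taylor remainder
    divided by \<open>\<tau> n\<close>, hence uniformly in x.\<close>
  have fD: "norm (f n x - D x v) \<le> 2 * B / \<rho> ^ 2 * \<tau> n" if x: "x \<in> ball a (R / 2)" for n x
  proof -
    let ?t = "of_real (\<tau> n) :: complex"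
    have t: "norm ?t = \<tau> n" using \<tau>[of n] by simp
    have "norm (h (x + ?t *s v) - (\<Sum>i<2. (deriv ^^ i) (\<lambda>t. h (x + t *s v)) 0 / fact i * ?t ^ i))
        \<le> 2 * B * (norm ?t / \<rho>) ^ 2"
      using sub[OF x] B \<tau>[of n] \<rho> by (intro Taylor_remainder_bound holo_line[OF h]) auto
    also have "(\<Sum>i<2. (deriv ^^ i) (\<lambda>t. h (x + t *s v)) 0 / fact i * ?t ^ i) = h x + D x v * ?t"
      using DERIV_imp_deriv[OF holo_line_has_field_derivative[OF h, of x 0 v]] x \<open>R > 0\<close>
      by (simp add: numeral_2_eq_2 D_def)
    also have "h (x + ?t *s v) - (h x + D x v * ?t) = ?t * (f n x - D x v)"
      using \<tau>[of n] by (simp add: f_def field_simps)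
    finally have "\<tau> n * norm (f n x - D x v) \<le> 2 * B * (\<tau> n / \<rho>) ^ 2"
      unfolding norm_mult t .
    also have "\<dots> = \<tau> n * (2 * B / \<rho> ^ 2 * \<tau> n)"
      by (simp add: power2_eq_square field_simps)
    finally show ?thesis
      using \<tau>[of n] mult_left_le_imp_le by blast
  qed
  have fh: "holo (f n) (ball a (R / 2))" for n
    unfolding f_def[abs_def]
    using sub[of _ "of_real (\<tau> n)"] \<tau>[of n] \<rho> \<open>R > 0\<close>
    by (intro holo_cmult holo_diff holo_translate[OF h] holo_subset[OF h]) auto
  define f' where "f' n x = frechet_derivative (f n) (at x)" for n x
  have f': "(f n has_derivative f' n x) (at x)" if "x \<in> ball a (R / 2)" for n x
    unfolding f'_def by (rule frechet_holo(1)[OF fh that])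
  \<comment> \<open>Cauchy's estimate on balls of radius R / 4 about points of the quarter ball
    converts the uniform bound on \<open>f n - f m\<close> into one on the derivatives.\<close>
  define K where "K = 2 * B / \<rho> ^ 2 / (R / 4)"
  have cau: "norm (f' n x u - f' m x u) \<le> K * (\<tau> n + \<tau> m) * norm u" if x: "x \<in> ball a (R / 4)" for n m x u
  proof -
    have sub': "ball x (R / 4) \<subseteq> ball a (R / 2)"
    proof
      fix y assume "y \<in> ball x (R / 4)"
      then show "y \<in> ball a (R / 2)"
        using x dist_triangle[of a y x] by auto
    qed
    have "norm (frechet_derivative (\<lambda>x. f n x - f m x) (at x) u)
        \<le> (2 * B / \<rho> ^ 2 * (\<tau> n + \<tau> m)) / (R / 4) * norm u"
    proof (rule frechet_holo_bound)
      show "holo (\<lambda>x. f n x - f m x) (ball x (R / 4))"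
        by (intro holo_diff holo_subset[OF fh] sub')
      fix y assume "y \<in> ball x (R / 4)"
      then have "y \<in> ball a (R / 2)" using sub' by auto
      from fD[OF this, of n] fD[OF this, of m]
      have "norm ((f n y - D y v) - (f m y - D y v)) \<le> 2 * B / \<rho> ^ 2 * \<tau> n + 2 * B / \<rho> ^ 2 * \<tau> m"
        by (intro order_trans[OF norm_triangle_ineq4]) auto
      then show "norm (f n y - f m y) \<le> 2 * B / \<rho> ^ 2 * (\<tau> n + \<tau> m)"
        by (simp add: distrib_left)
    qed (use \<open>R > 0\<close> in auto)
    moreover have "x \<in> ball a (R / 2)"
      using x \<open>R > 0\<close> by auto
    then have "((\<lambda>x. f n x - f m x) has_derivative (\<lambda>u. f' n x u - f' m x u)) (at x)"
      by (intro has_derivative_diff f')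
    from frechet_derivative_at[OF this]
    have "frechet_derivative (\<lambda>x. f n x - f m x) (at x) u = f' n x u - f' m x u"
      by metis
    ultimately show ?thesis
      by (simp add: K_def)
  qed
  define S where "S = ball a (R / 4)"
  have K: "K \<ge> 0"
    using order_trans[OF norm_ge_zero B[of a]] \<open>R > 0\<close> by (auto simp: K_def)
  have ex: "\<exists>l. (\<lambda>n. f' n x u) \<longlonglongrightarrow> l" if "x \<in> S" for x u
  proof -
    have lim: "(\<lambda>n. 2 * (K * norm u) * \<tau> n) \<longlonglongrightarrow> 2 * (K * norm u) * 0"
      by (intro tendsto_intros \<tau>0)
    have "Cauchy (\<lambda>n. f' n x u)"
    proof (rule CauchyI)
      fix e :: real assume "e > 0"
      then obtain N where N: "2 * (K * norm u) * \<tau> N < e"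
        using order_tendstoD(2)[OF lim, of e] by (auto simp: eventually_sequentially)
      have "norm (f' m x u - f' n x u) < e" if "m \<ge> N" "n \<ge> N" for m n
      proof -
        have "\<tau> m \<le> \<tau> N" "\<tau> n \<le> \<tau> N"
          using that \<rho>(1) by (auto simp: \<tau>_def field_simps)
        then have "K * norm u * (\<tau> m + \<tau> n) \<le> K * norm u * (2 * \<tau> N)"
          using K by (intro mult_left_mono) auto
        then show ?thesis
          using cau[of x m u n] \<open>x \<in> S\<close> N by (simp add: S_def algebra_simps)
      qed
      then show "\<exists>M. \<forall>m\<ge>M. \<forall>n\<ge>M. norm (f' m x u - f' n x u) < e" by blast
    qed
    then show ?thesis
      using Cauchy_convergent by (auto simp: convergent_def)
  qed
  then obtain g' where g': "\<And>x u. x \<in> S \<Longrightarrow> (\<lambda>n. f' n x u) \<longlonglongrightarrow> g' x u"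
    by metis
  have g'_le: "norm (f' n x u - g' x u) \<le> K * \<tau> n * norm u" if "x \<in> S" for n x u
  proof (rule tendsto_le)
    show "(\<lambda>m. norm (f' n x u - f' m x u)) \<longlonglongrightarrow> norm (f' n x u - g' x u)"
      by (intro tendsto_intros g' that)
    have "(\<lambda>m. K * (\<tau> n + \<tau> m) * norm u) \<longlonglongrightarrow> K * (\<tau> n + 0) * norm u"
      by (intro tendsto_intros \<tau>0)
    then show "(\<lambda>m. K * (\<tau> n + \<tau> m) * norm u) \<longlonglongrightarrow> K * \<tau> n * norm u" by simp
    show "\<forall>\<^sub>F m in sequentially. norm (f' n x u - f' m x u) \<le> K * (\<tau> n + \<tau> m) * norm u"
      using cau that by (auto simp: S_def)
  qed simp
  have flim: "(\<lambda>n. f n x) \<longlonglongrightarrow> D x v" if "x \<in> S" for x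
  proof (rule LIM_zero_cancel, rule Lim_null_comparison)
    have "(\<lambda>n. 2 * B / \<rho> ^ 2 * \<tau> n) \<longlonglongrightarrow> 2 * B / \<rho> ^ 2 * 0"
      by (intro tendsto_intros \<tau>0)
    then show "(\<lambda>n. 2 * B / \<rho> ^ 2 * \<tau> n) \<longlonglongrightarrow> 0" by simp
    show "\<forall>\<^sub>F n in sequentially. norm (f n x - D x v) \<le> 2 * B / \<rho> ^ 2 * \<tau> n"
      using fD that \<open>R > 0\<close> by (auto simp: S_def)
  qed
  have "\<exists>g. \<forall>x\<in>S. (\<lambda>n. f n x) \<longlonglongrightarrow> g x \<and> (g has_derivative g' x) (at x within S)"
  proof (rule has_derivative_sequence)
    show "convex S" "a \<in> S" using \<open>R > 0\<close> by (auto simp: S_def)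
    then show "(\<lambda>n. f n a) \<longlonglongrightarrow> D a v" by (intro flim)
    show "(f n has_derivative f' n x) (at x within S)" if "x \<in> S" for n x
      using that \<open>R > 0\<close> by (intro has_derivative_at_withinI[OF f']) (auto simp: S_def)
    fix e :: real assume "e > 0"
    have "(\<lambda>n. K * \<tau> n) \<longlonglongrightarrow> K * 0"
      by (intro tendsto_intros \<tau>0)
    then have "\<forall>\<^sub>F n in sequentially. K * \<tau> n < e"
      using \<open>e > 0\<close> by (intro order_tendstoD(2)) auto
    then show "\<forall>\<^sub>F n in sequentially. \<forall>x\<in>S. \<forall>u. norm (f' n x u - g' x u) \<le> e * norm u"
    proof eventually_elim
      case (elim n)
      show ?case
      proof safe
        fix x u assume "x \<in> S"
        then have "norm (f' n x u - g' x u) \<le> K * \<tau> n * norm u"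
          by (rule g'_le)
        also have "\<dots> \<le> e * norm u"
          using elim by (intro mult_right_mono) auto
        finally show "norm (f' n x u - g' x u) \<le> e * norm u" .
      qed
    qed
  qed
  then obtain g where g: "\<And>x. x \<in> S \<Longrightarrow> (\<lambda>n. f n x) \<longlonglongrightarrow> g x"
    "\<And>x. x \<in> S \<Longrightarrow> (g has_derivative g' x) (at x within S)"
    by blast
  have gD: "g x = D x v" if "x \<in> S" for x
    using LIMSEQ_unique[OF g(1) flim] that by auto
  have S: "open S" "a \<in> S" using \<open>R > 0\<close> by (auto simp: S_def)
  have "((\<lambda>x. D x v) has_derivative g' a) (at a)"
  proof (rule has_derivative_transform_within_open[OF _ S])
    show "(g has_derivative g' a) (at a)"
      using g(2)[OF S(2)] at_within_open[OF S(2) S(1)] by simp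
  qed (use gD in auto)
  then show ?thesis
    unfolding D_def differentiable_def by blast
qed

section \<open>Anisotropic dilations and weighted Taylor coefficients\<close>

definition dil :: "('m::finite \<Rightarrow> nat) \<Rightarrow> complex \<Rightarrow> complex^'m \<Rightarrow> complex^'m" where
  "dil wt t x = (\<chi> i. t ^ wt i * x $ i)"

text \<open>The weighted homogeneous part of h of degree k: the coefficient collects the monomials
  of total weight k, without any multi-indices.\<close>

definition wcoef :: "('m::finite \<Rightarrow> nat) \<Rightarrow> (complex^'m \<Rightarrow> complex) \<Rightarrow> nat \<Rightarrow> complex^'m \<Rightarrow> complex" where
  "wcoef wt h k x = (deriv ^^ k) (\<lambda>t. h (dil wt t x)) 0 / fact k"

lemma norm_dil_le:
  assumes "\<And>i. wt i \<ge> 1" "norm t \<le> 1"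
  shows "norm (dil wt t x) \<le> norm t * norm x"
proof -
  have "norm (dil wt t x) \<le> norm (t *s x)"
    unfolding norm_vec_def
  proof (rule L2_set_mono)
    fix i
    have "norm t ^ wt i \<le> norm t ^ 1"
      using assms by (intro power_decreasing) auto
    then show "norm (dil wt t x $ i) \<le> norm ((t *s x) $ i)"
      by (simp add: dil_def norm_mult norm_power mult_right_mono)
  qed auto
  then show ?thesis by (simp add: norm_smult_cart)
qed

lemma dil_dil: "dil wt s (dil wt t x) = dil wt (s * t) x"
  by (simp add: dil_def vec_eq_iff power_mult_distrib mult_ac)

lemma dil_1: "dil wt 1 x = x"
  by (simp add: dil_def vec_eq_iff)

locale bounded_holo =
  fixes wt :: "'m::finite \<Rightarrow> nat" and h :: "complex^'m \<Rightarrow> complex" and r B :: real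
  assumes wt: "\<And>i. wt i \<ge> 1" and h: "holo h (ball 0 r)" and r: "r > 0"
    and B: "\<And>x. x \<in> ball 0 r \<Longrightarrow> norm (h x) \<le> B"
begin

text \<open>Parameters below \<open>rad K\<close> dilate the ball of radius K into the domain of h.
  The minimum with 1 keeps dilations from increasing the norm, and K + 1 avoids division by
  0.\<close>

definition rad :: "real \<Rightarrow> real" where "rad K = min 1 (r / (K + 1))"

lemma rad_pos: "K \<ge> 0 \<Longrightarrow> rad K > 0"
  using r by (simp add: rad_def)

lemma dil_in_ball:
  assumes "norm t < rad K" "norm x \<le> K"
  shows "dil wt t x \<in> ball 0 r"
proof -
  have K: "K \<ge> 0" using assms(2) norm_ge_zero order_trans by blast
  have "norm (dil wt t x) \<le> norm t * norm x"
    using assms by (intro norm_dil_le wt) (auto simp: rad_def)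
  also have "\<dots> \<le> norm t * (K + 1)"
    using assms by (intro mult_left_mono) auto
  also have "\<dots> < r"
    using assms(1) K by (simp add: rad_def field_simps)
  finally show ?thesis by simp
qed

lemma dil_holomorphic:
  assumes "norm x \<le> K"
  shows "(\<lambda>t. h (dil wt t x)) holomorphic_on ball 0 (rad K)"
  using dil_in_ball[OF _ assms]
  by (intro holo_comp_curve[OF h]) (auto simp: dil_def intro!: holomorphic_intros)

lemma weighted_Taylor:
  assumes "norm x \<le> K" "norm t \<le> rad K / 2"
  shows "norm (h (dil wt t x) - (\<Sum>i<k. wcoef wt h i x * t ^ i)) \<le> 2 * B * (norm t / rad K) ^ k"
  unfolding wcoef_def
  using assms dil_in_ball[OF _ assms(1)] B order_trans[OF norm_ge_zero assms(1)]
  by (intro Taylor_remainder_bound dil_holomorphic rad_pos) auto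

lemma weighted_leading:
  assumes "\<And>i x. i < k \<Longrightarrow> wcoef wt h i x = 0" "norm x \<le> K" "norm t \<le> rad K / 2"
  shows "norm (h (dil wt t x) - wcoef wt h k x * t ^ k) \<le> 2 * B * (norm t / rad K) ^ Suc k"
proof -
  have "(\<Sum>i<Suc k. wcoef wt h i x * t ^ i) = wcoef wt h k x * t ^ k"
    using assms(1) by simp
  then show ?thesis
    using weighted_Taylor[OF assms(2,3), of "Suc k"] by metis
qed

lemma weighted_leading':
  assumes "\<And>i x. i < k \<Longrightarrow> wcoef wt h i x = 0" "norm x \<le> K" "norm t \<le> rad K / 2" "t \<noteq> 0"
  shows "norm (h (dil wt t x) / t ^ k - wcoef wt h k x) \<le> 2 * B / rad K ^ Suc k * norm t"
proof -
  have "h (dil wt t x) / t ^ k - wcoef wt h k x = (h (dil wt t x) - wcoef wt h k x * t ^ k) / t ^ k"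
    using assms(4) by (simp add: field_simps)
  also have "norm \<dots> \<le> 2 * B * (norm t / rad K) ^ Suc k / norm t ^ k"
    unfolding norm_divide norm_power by (intro divide_right_mono weighted_leading assms) auto
  also have "\<dots> = 2 * B / rad K ^ Suc k * norm t"
    using assms(4) by (simp add: power_divide)
  finally show ?thesis .
qed

text \<open>When the lower coefficients vanish, the leading one is the limit of rescalings of h,
  uniformly on balls of any size. Its regularity on the whole space comes from this limit.\<close>

lemma uniform_limit_wcoef:
  assumes "\<And>i x. i < k \<Longrightarrow> wcoef wt h i x = 0" "K \<ge> 0"
  shows "uniform_limit (cball 0 K) (\<lambda>\<tau> x. h (dil wt (of_real \<tau>) x) / of_real \<tau> ^ k) (wcoef wt h k) (at_right 0)"
proof (rule uniform_limitI)
  fix e :: real assume "e > 0"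
  have "((\<lambda>\<tau>. 2 * B / rad K ^ Suc k * \<tau>) \<longlongrightarrow> 2 * B / rad K ^ Suc k * 0) (at_right 0)"
    by (intro tendsto_intros)
  then have "\<forall>\<^sub>F \<tau> in at_right 0. 2 * B / rad K ^ Suc k * \<tau> < e"
    using \<open>e > 0\<close> by (intro order_tendstoD(2)) auto
  moreover have "\<forall>\<^sub>F \<tau> in at_right 0. \<tau> \<in> {0<..<rad K / 2}"
    using rad_pos[OF assms(2)] by (intro eventually_at_right_real) auto
  ultimately show "\<forall>\<^sub>F \<tau> in at_right 0. \<forall>x\<in>cball 0 K.
      dist (h (dil wt (of_real \<tau>) x) / of_real \<tau> ^ k) (wcoef wt h k x) < e"
  proof eventually_elim
    case (elim \<tau>)
    show ?case
    proof
      fix x :: "complex^'m" assume "x \<in> cball 0 K"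
      then show "dist (h (dil wt (of_real \<tau>) x) / of_real \<tau> ^ k) (wcoef wt h k x) < e"
        using weighted_leading'[OF assms(1), of k x K "of_real \<tau>"] elim by (simp add: dist_norm)
    qed
  qed
qed

lemma eventually_dil_in_ball:
  assumes "K \<ge> 0"
  shows "\<forall>\<^sub>F \<tau> in at_right 0. \<forall>x\<in>cball 0 K. dil wt (complex_of_real \<tau>) x \<in> ball 0 r"
proof -
  have "\<forall>\<^sub>F \<tau> in at_right 0. \<tau> \<in> {0<..<rad K}"
    using rad_pos[OF assms] by (intro eventually_at_right_real) auto
  then show ?thesis
    by eventually_elim (intro ballI dil_in_ball[of _ K]; simp)
qed

lemma continuous_wcoef:
  assumes "\<And>i x. i < k \<Longrightarrow> wcoef wt h i x = 0"
  shows "continuous_on UNIV (wcoef wt h k)"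
proof -
  have *: "continuous_on (cball 0 K) (wcoef wt h k)" if "K \<ge> 0" for K
  proof (rule uniform_limit_theorem[OF _ uniform_limit_wcoef[OF assms \<open>K \<ge> 0\<close>]])
    show "\<forall>\<^sub>F \<tau> in at_right 0. continuous_on (cball 0 K) (\<lambda>x. h (dil wt (of_real \<tau>) x) / of_real \<tau> ^ k)"
      using eventually_dil_in_ball[OF that] eventually_at_right_less[of 0]
    proof eventually_elim
      case (elim \<tau>)
      then show ?case
        unfolding dil_def
        by (intro continuous_intros continuous_on_compose2[OF holo_continuous_on[OF h]]) auto
    qed
  qed auto
  have "continuous (at x) (wcoef wt h k)" for x
    using continuous_on_subset[OF *[of "norm x + 1"], of "ball 0 (norm x + 1)"]
    by (auto simp: continuous_on_eq_continuous_at)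
  then show ?thesis
    by (simp add: continuous_on_eq_continuous_within)
qed

text \<open>A Weierstrass limit: on each disc the curve is bounded, so for small \<tau> its dilation
  lies in the ball of radius r, where composition with h is holomorphic.\<close>

lemma wcoef_comp_curve:
  assumes "\<And>i x. i < k \<Longrightarrow> wcoef wt h i x = 0" "\<And>i. (\<lambda>s. \<gamma> s $ i) holomorphic_on UNIV"
  shows "(\<lambda>s. wcoef wt h k (\<gamma> s)) holomorphic_on UNIV"
proof -
  have "continuous_on UNIV (\<lambda>s. \<chi> i. \<gamma> s $ i)"
    by (intro continuous_intros holomorphic_on_imp_continuous_on assms)
  then have \<gamma>: "continuous_on S \<gamma>" for S
    by (auto intro: continuous_on_subset)
  have *: "(\<lambda>s. wcoef wt h k (\<gamma> s)) holomorphic_on ball 0 R" for R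
  proof -
    have "compact (\<gamma> ` cball 0 R)"
      by (intro compact_continuous_image \<gamma> compact_cball)
    from compact_imp_bounded[OF this] obtain K where K: "K > 0" "\<And>s. s \<in> cball 0 R \<Longrightarrow> norm (\<gamma> s) \<le> K"
      unfolding bounded_pos by auto
    have ul: "uniform_limit (cball 0 R) (\<lambda>\<tau> s. h (dil wt (of_real \<tau>) (\<gamma> s)) / of_real \<tau> ^ k)
        (\<lambda>s. wcoef wt h k (\<gamma> s)) (at_right 0)"
    proof (rule uniform_limitI)
      fix e :: real assume "e > 0"
      from uniform_limitD[OF uniform_limit_wcoef[OF assms(1), of k K] this] K
      show "\<forall>\<^sub>F \<tau> in at_right 0. \<forall>s\<in>cball 0 R.
          dist (h (dil wt (of_real \<tau>) (\<gamma> s)) / of_real \<tau> ^ k) (wcoef wt h k (\<gamma> s)) < e"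
        by (auto elim!: eventually_mono)
    qed
    have "\<forall>\<^sub>F \<tau> in at_right 0.
        continuous_on (cball 0 R) (\<lambda>s. h (dil wt (of_real \<tau>) (\<gamma> s)) / of_real \<tau> ^ k) \<and>
        (\<lambda>s. h (dil wt (of_real \<tau>) (\<gamma> s)) / of_real \<tau> ^ k) holomorphic_on ball 0 R"
      using eventually_dil_in_ball[OF less_imp_le[OF K(1)]] eventually_at_right_less[of 0]
    proof eventually_elim
      case (elim \<tau>)
      have "continuous_on (cball 0 R) (\<lambda>s. h (dil wt (of_real \<tau>) (\<gamma> s)) / of_real \<tau> ^ k)"
        unfolding dil_def
        using elim K(2)
        by (intro continuous_intros continuous_on_compose2[OF holo_continuous_on[OF h]] \<gamma>)
           (auto simp: dil_def)
      moreover have "(\<lambda>s. h (dil wt (of_real \<tau>) (\<gamma> s))) holomorphic_on ball 0 R"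
        using elim K(2)
        by (intro holo_comp_curve[OF h])
           (auto simp: dil_def intro!: holomorphic_intros holomorphic_on_subset[OF assms(2)])
      ultimately show ?case
        using elim by (auto intro!: holomorphic_intros)
    qed
    then show ?thesis
      using holomorphic_uniform_limit[OF _ ul] by auto
  qed
  show ?thesis
    unfolding holomorphic_on_open[OF open_UNIV]
  proof
    fix s
    show "\<exists>f'. ((\<lambda>s. wcoef wt h k (\<gamma> s)) has_field_derivative f') (at s)"
      using *[of "norm s + 1"] unfolding holomorphic_on_open[OF open_ball] by auto
  qed
qed

text \<open>The evaluation point may move with \<tau>, because a point of the quadric has to be
  corrected for each \<tau> before its dilation lies on M.\<close>

lemma wcoef_limit:
  assumes "\<And>i x. i < k \<Longrightarrow> wcoef wt h i x = 0" "(X \<longlongrightarrow> x) (at_right 0)"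
  shows "((\<lambda>\<tau>. h (dil wt (of_real \<tau>) (X \<tau>)) / of_real \<tau> ^ k) \<longlongrightarrow> wcoef wt h k x) (at_right 0)"
proof -
  have X: "\<forall>\<^sub>F \<tau> in at_right 0. X \<tau> \<in> ball 0 (norm x + 1)"
    by (rule topological_tendstoD[OF assms(2)]) auto
  have c: "((\<lambda>\<tau>. wcoef wt h k (X \<tau>)) \<longlongrightarrow> wcoef wt h k x) (at_right 0)"
    using continuous_on_tendsto_compose[OF continuous_wcoef[OF assms(1)] assms(2)] by auto
  have "((\<lambda>\<tau>. h (dil wt (of_real \<tau>) (X \<tau>)) / of_real \<tau> ^ k - wcoef wt h k (X \<tau>)) \<longlongrightarrow> 0) (at_right 0)"
  proof (rule tendstoI)
    fix e :: real assume "e > 0"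
    have "\<forall>\<^sub>F \<tau> in at_right 0. \<forall>x\<in>cball 0 (norm x + 1).
        dist (h (dil wt (of_real \<tau>) x) / of_real \<tau> ^ k) (wcoef wt h k x) < e"
      by (rule uniform_limitD[OF uniform_limit_wcoef[OF assms(1)] \<open>e > 0\<close>]) auto
    with X show "\<forall>\<^sub>F \<tau> in at_right 0.
        dist (h (dil wt (of_real \<tau>) (X \<tau>)) / of_real \<tau> ^ k - wcoef wt h k (X \<tau>)) 0 < e"
      by eventually_elim (auto simp: dist_norm)
  qed
  from tendsto_add[OF this c] show ?thesis by simp
qed

lemma wcoef_bound:
  assumes "norm x \<le> K" "\<And>t. norm t < rad K \<Longrightarrow> norm (h (dil wt t x)) \<le> C"
  shows "norm (wcoef wt h k x) \<le> C / rad K ^ k"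
  unfolding wcoef_def using assms order_trans[OF norm_ge_zero assms(1)]
  by (intro Cauchy_coeff_bound dil_holomorphic rad_pos) auto

lemma eventually_0_if_wcoef_0:
  assumes "\<And>k x. wcoef wt h k x = 0"
  shows "\<forall>\<^sub>F x in nhds 0. h x = 0"
proof -
  \<comment> \<open>One fixed parameter suffices: norm t / \<open>rad 1\<close> is 1 / 4, so the
    remainder 2 B / 4^k tends to 0 with growing k, while the dilations by t of the unit ball cover a
    neighbourhood of 0.\<close>
  define t where "t = complex_of_real (rad 1 / 4)"
  have t: "norm t = rad 1 / 4" "t \<noteq> 0"
    using rad_pos[of 1] by (auto simp: t_def)
  have *: "h (dil wt t x) = 0" if "norm x \<le> 1" for x
  proof -
    have "norm (h (dil wt t x)) \<le> 2 * B * (1 / 4) ^ k" for k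
      using weighted_Taylor[OF that, of t k] t rad_pos[of 1] assms by simp
    moreover have "(\<lambda>k. 2 * B * (1 / 4) ^ k) \<longlonglongrightarrow> 2 * B * 0"
      by (intro tendsto_intros LIMSEQ_power_zero) auto
    ultimately have "norm (h (dil wt t x)) \<le> 2 * B * 0"
      by (intro tendsto_lowerbound[of _ _ sequentially]) auto
    then show ?thesis by simp
  qed
  have "continuous_on UNIV (dil wt (1 / t))"
    unfolding dil_def by (intro continuous_intros)
  then have "open (dil wt (1 / t) -` ball 0 1)"
    by (intro open_vimage) auto
  moreover have "0 \<in> dil wt (1 / t) -` ball 0 1"
    by (simp add: dil_def vec_eq_iff zero_vec_def[symmetric])
  ultimately have "\<forall>\<^sub>F x in nhds 0. x \<in> dil wt (1 / t) -` ball 0 1"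
    by (rule eventually_nhds_in_open)
  then show ?thesis
  proof eventually_elim
    case (elim x)
    then have "h (dil wt t (dil wt (1 / t) x)) = 0"
      by (intro *) auto
    then show ?case
      using t by (simp add: dil_dil dil_1)
  qed
qed

text \<open>All weights are at least 1, so order m in x gives order at least m in t along the curves
  \<open>dil wt t x\<close>.\<close>

lemma wcoef_eq_0:
  assumes "\<And>x. x \<in> ball 0 r \<Longrightarrow> norm (h x) \<le> C * norm x ^ m" "C \<ge> 0" "i < m"
  shows "wcoef wt h i x = 0"
proof -
  have "(deriv ^^ i) (\<lambda>t. h (dil wt t x)) 0 = 0"
  proof (rule Taylor_coeff_eq_0[OF dil_holomorphic[OF order_refl] rad_pos _ \<open>i < m\<close>])
    fix t :: complex assume t: "norm t < rad (norm x)"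
    have "norm (h (dil wt t x)) \<le> C * norm (dil wt t x) ^ m"
      using dil_in_ball[OF t] by (intro assms) auto
    also have "\<dots> \<le> C * (norm t * norm x) ^ m"
      using t by (intro mult_left_mono power_mono norm_dil_le wt assms) (auto simp: rad_def)
    finally show "norm (h (dil wt t x)) \<le> (C * norm x ^ m) * norm t ^ m"
      by (simp add: power_mult_distrib mult_ac)
  qed auto
  then show ?thesis by (simp add: wcoef_def)
qed

text \<open>Dilations with norm t at most 1 do not increase the norm, so by Cauchy every coefficient
  inherits the bound. With m = 3 it supplies the vanishing order that contradicts quadratic
  growth.\<close>

lemma wcoef_bound_power:
  assumes "\<And>x. x \<in> ball 0 r \<Longrightarrow> norm (h x) \<le> C * norm x ^ m" "C \<ge> 0" "norm x \<le> K"
  shows "norm (wcoef wt h k x) \<le> C / rad K ^ k * norm x ^ m"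
proof -
  have "norm (wcoef wt h k x) \<le> (C * norm x ^ m) / rad K ^ k"
  proof (rule wcoef_bound[OF assms(3)])
    fix t :: complex assume t: "norm t < rad K"
    have "norm (h (dil wt t x)) \<le> C * norm (dil wt t x) ^ m"
      using dil_in_ball[OF t assms(3)] by (intro assms) auto
    also have "norm (dil wt t x) \<le> 1 * norm x"
      using t by (intro order_trans[OF norm_dil_le[OF wt]] mult_right_mono) (auto simp: rad_def)
    then have "C * norm (dil wt t x) ^ m \<le> C * norm x ^ m"
      by (intro mult_left_mono power_mono assms) auto
    finally show "norm (h (dil wt t x)) \<le> C * norm x ^ m" .
  qed
  then show ?thesis by (simp add: mult_ac)
qed

end

section \<open>Infinitesimal automorphisms of the quadric\<close>

definition mk :: "complex^'n \<Rightarrow> complex^'d \<Rightarrow> complex^('n::finite + 'd::finite)" where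
  "mk z w = (\<chi> c. case c of Inl i \<Rightarrow> z $ i | Inr j \<Rightarrow> w $ j)"

lemma mk_nth [simp]: "mk z w $ Inl i = z $ i" "mk z w $ Inr j = w $ j"
  by (simp_all add: mk_def)

lemma parts_mk [simp]: "z_part (mk z w) = z" "w_part (mk z w) = w"
  by (simp_all add: z_part_def w_part_def vec_eq_iff)

lemma mk_parts [simp]: "mk (z_part x) (w_part x) = x"
  unfolding vec_eq_iff
proof
  fix c show "mk (z_part x) (w_part x) $ c = x $ c"
    by (cases c) (auto simp: z_part_def w_part_def)
qed

lemma smult_mk: "c *s mk z w = mk (c *s z) (c *s w)"
  unfolding vec_eq_iff
proof
  fix i show "(c *s mk z w) $ i = mk (c *s z) (c *s w) $ i"
    by (cases i) auto
qed

lemma mk_0 [simp]: "mk 0 0 = 0"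
  unfolding vec_eq_iff
proof
  fix c show "(mk 0 0 :: complex^('a + 'b)) $ c = 0 $ c"
    by (cases c) auto
qed

lemma continuous_on_mk [continuous_intros]:
  assumes "continuous_on S F" "continuous_on S G"
  shows "continuous_on S (\<lambda>x. mk (F x) (G x))"
  unfolding mk_def
proof (rule continuous_on_vec_lambda)
  fix c show "continuous_on S (\<lambda>x. case c of Inl i \<Rightarrow> F x $ i | Inr j \<Rightarrow> G x $ j)"
    using assms by (cases c) (auto intro!: continuous_intros)
qed

section \<open>Sesquilinear forms of Hermitian matrices\<close>

definition sesq :: "complex^'n^'n \<Rightarrow> complex^'n \<Rightarrow> complex^'n \<Rightarrow> complex" where
  "sesq A a b = (\<Sum>i\<in>UNIV. cnj (a $ i) * (A *v b) $ i)"

lemma herm_form_sesq: "herm_form A z = sesq A z z"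
  by (simp add: herm_form_def sesq_def)

lemma sesq_expand: "sesq A a b = (\<Sum>i\<in>UNIV. \<Sum>k\<in>UNIV. cnj (a $ i) * (A $ i $ k * b $ k))"
  by (simp add: sesq_def matrix_vector_mult_def sum_distrib_left)

lemma sesq_add_left: "sesq A (a + a') b = sesq A a b + sesq A a' b"
  by (simp add: sesq_def algebra_simps sum.distrib)

lemma sesq_add_right: "sesq A a (b + b') = sesq A a b + sesq A a b'"
  by (simp add: sesq_def algebra_simps sum.distrib matrix_vector_right_distrib)

lemma sesq_smult_left: "sesq A (c *s a) b = cnj c * sesq A a b"
  by (simp add: sesq_def sum_distrib_left mult_ac)

lemma sesq_smult_right: "sesq A a (c *s b) = c * sesq A a b"
  by (simp add: sesq_expand sum_distrib_left mult_ac)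

lemma sesq_0_left [simp]: "sesq A 0 b = 0"
  by (simp add: sesq_def)

lemma sesq_0_right [simp]: "sesq A a 0 = 0"
  by (simp add: sesq_def)

lemma cnj_sesq:
  assumes "hermitian A"
  shows "cnj (sesq A a b) = sesq A b a"
proof -
  have cnj_A: "cnj (A $ i $ k) = A $ k $ i" for i k
    using assms by (metis hermitian_def)
  have "cnj (sesq A a b) = (\<Sum>i\<in>UNIV. \<Sum>k\<in>UNIV. a $ i * (A $ k $ i * cnj (b $ k)))"
    unfolding sesq_expand by (simp add: cnj_A)
  also have "\<dots> = sesq A b a"
    unfolding sesq_expand by (subst sum.swap) (simp add: mult_ac)
  finally show ?thesis .
qed

lemma continuous_on_sesq [continuous_intros]:
  "continuous_on S F \<Longrightarrow> continuous_on S G \<Longrightarrow> continuous_on S (\<lambda>x. sesq A (F x) (G x))"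
  unfolding sesq_expand by (intro continuous_intros)

text \<open>The pair (f, g) of leading terms as one indexed family. Holomorphy along entire curves
  and continuity are what the limit of rescalings delivers; \<open>tangent\<close> says that the
  field (f, g) is tangent to the quadric along it.\<close>

locale quadric_field =
  fixes A :: "'d::finite \<Rightarrow> complex^'n::finite^'n" and h :: "'n + 'd \<Rightarrow> complex^('n + 'd) \<Rightarrow> complex"
  assumes herm: "\<And>j. hermitian (A j)"
    and hol: "\<And>\<gamma> c. (\<And>i. (\<lambda>s. \<gamma> s $ i) holomorphic_on UNIV) \<Longrightarrow> (\<lambda>s. h c (\<gamma> s)) holomorphic_on UNIV"
    and cont: "\<And>c. continuous_on UNIV (h c)"
    and tangent: "\<And>x j. (\<And>j. Re (w_part x $ j) = Re (sesq (A j) (z_part x) (z_part x))) \<Longrightarrow>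
      Re (h (Inr j) x) = 2 * Re (sesq (A j) (z_part x) (\<chi> i. h (Inl i) x))"
begin

definition f :: "complex^('n + 'd) \<Rightarrow> complex^'n" where "f x = (\<chi> i. h (Inl i) x)"
abbreviation "g j \<equiv> h (Inr j)"

text \<open>The points with z-parts p + l q and p + cnj l q (for l and cnj l) coincide for real l, where the
  identity is the tangency condition; both sides are holomorphic in l, and l = i gives the
  general pair.\<close>

lemma polarized:
  assumes "\<And>j. w $ j + cnj (w' $ j) = 2 * sesq (A j) z' z"
  shows "g j (mk z w) + cnj (g j (mk z' w'))
    = 2 * sesq (A j) z' (f (mk z w)) + 2 * cnj (sesq (A j) z (f (mk z' w')))"
proof -
  define p where "p = (1 / 2) *s (z + z')"
  define q where "q = (1 / (2 * \<i>)) *s (z - z')"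
  define Z where "Z l = p + l *s q" for l
  have Zi: "Z \<i> = z" "Z (- \<i>) = z'"
    by (auto simp: Z_def p_def q_def vec_eq_iff field_simps)
  \<comment> \<open>The deviation of w from \<open>sesq (A j) z' z\<close> is spread affinely over
    l: \<open>nu\<close> is real for real l, so that \<open>X l\<close> then lies on the quadric,
    and it takes the value y at l = i.\<close>
  define y where "y j = (w $ j - sesq (A j) z' z) / \<i>" for j
  define nu where "nu l j = of_real (Re (y j)) + l * of_real (Im (y j))" for l :: complex and j
  have nu: "nu \<i> j = y j" "nu (- \<i>) j = cnj (y j)" for j
    by (auto simp: nu_def complex_eq_iff)
  define W where "W l = (\<chi> j. sesq (A j) p p + l * (sesq (A j) p q + sesq (A j) q p)
      + l ^ 2 * sesq (A j) q q + \<i> * nu l j)" for l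
  have W: "W l $ j = sesq (A j) (Z (cnj l)) (Z l) + \<i> * nu l j" for l j
    by (simp add: W_def Z_def sesq_add_left sesq_add_right sesq_smult_left sesq_smult_right
        algebra_simps power2_eq_square)
  have Wi: "W \<i> = w" "W (- \<i>) = w'"
  proof -
    show "W \<i> = w"
      by (simp add: vec_eq_iff W Zi nu y_def)
    have "W (- \<i>) $ j = w' $ j" for j
    proof -
      have "cnj (w $ j + cnj (w' $ j)) = 2 * sesq (A j) z z'"
        using assms[of j] by (simp add: cnj_sesq herm)
      then have w': "w' $ j = 2 * sesq (A j) z z' - cnj (w $ j)"
        by (simp add: eq_diff_eq add.commute)
      have "\<i> * cnj (y j) = - (cnj (w $ j) - sesq (A j) z z')"
        by (simp add: y_def cnj_sesq herm field_simps)
      then have "W (- \<i>) $ j = sesq (A j) z z' - (cnj (w $ j) - sesq (A j) z z')"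
        unfolding W nu by (simp add: Zi)
      then show ?thesis
        by (simp add: w')
    qed
    then show "W (- \<i>) = w'" by (simp add: vec_eq_iff)
  qed
  define X where "X l = mk (Z l) (W l)" for l
  have X: "(\<lambda>l. X l $ c) holomorphic_on UNIV" for c
    by (cases c) (auto simp: X_def Z_def W_def nu_def intro!: holomorphic_intros)
  have hX: "(\<lambda>l. h c (X l)) holomorphic_on UNIV" for c
    by (rule hol[OF X])
  \<comment> \<open>Conjugating both the value and the parameter turns the conjugated terms into
    holomorphic functions of l.\<close>
  have hX': "(\<lambda>l. cnj (h c (X (cnj l)))) holomorphic_on UNIV" for c
  proof -
    have "cnj ` UNIV = UNIV"
      by (rule surjI[of _ cnj]) simp
    then show ?thesis
      using holomorphic_on_compose_cnj_cnj[of "\<lambda>l. h c (X l)" UNIV] hX by (simp add: o_def)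
  qed
  define T where "T l = g j (X l) + cnj (g j (X (cnj l)))
      - 2 * sesq (A j) (Z (cnj l)) (f (X l)) - 2 * cnj (sesq (A j) (Z l) (f (X (cnj l))))" for l
  have T: "T = (\<lambda>l. g j (X l) + cnj (g j (X (cnj l)))
      - 2 * (\<Sum>i\<in>UNIV. \<Sum>k\<in>UNIV. (cnj (p $ i) + l * cnj (q $ i)) * (A j $ i $ k * h (Inl k) (X l)))
      - 2 * (\<Sum>i\<in>UNIV. \<Sum>k\<in>UNIV. (p $ i + l * q $ i) * (cnj (A j $ i $ k) * cnj (h (Inl k) (X (cnj l))))))"
    by (simp add: T_def sesq_expand Z_def f_def fun_eq_iff)
  have "T \<i> = 0"
  proof (rule entire_eq_0_if_eq_0_on_reals[of T])
    show "T holomorphic_on UNIV"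
      unfolding T by (intro holomorphic_intros hX hX')
    fix l :: real
    have "Re (w_part (X l) $ j) = Re (sesq (A j) (z_part (X l)) (z_part (X l)))" for j
      by (simp add: X_def W nu_def)
    from tangent[OF this, of j] show "T l = 0"
      by (simp add: T_def X_def f_def complex_eq_iff)
  qed
  then show ?thesis
    by (simp add: T_def X_def Zi Wi algebra_simps)
qed

text \<open>Two partners of the same point s y are compared, one with and one without the
  \<delta>-term. Subtracting their polarized identities cancels g (s y) and the \<omega>-term and
  leaves \<delta>^* A_j f (s y) / s, expressed through values at the partners, which lie in a
  compact set.\<close>

lemma f_vanishes_on_discs:
  assumes growth: "\<And>i K. \<exists>C. \<forall>x. norm x \<le> K \<longrightarrow> norm (h (Inl i) x) \<le> C * norm x ^ 3"
    and kernel: "\<And>v. (\<And>j. A j *v v = 0) \<Longrightarrow> v = 0"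
  shows "f (mk V (\<chi> j. 2 * sesq (A j) \<omega> V)) = 0"
proof -
  define y where "y = mk V (\<chi> j. 2 * sesq (A j) \<omega> V)"
  have y: "s *s y = mk (s *s V) (\<chi> j. 2 * s * sesq (A j) \<omega> V)" for s
    unfolding y_def smult_mk by (rule arg_cong2[of _ _ _ _ mk]) (auto simp: vec_eq_iff mult_ac)
  have zero: "sesq (A j) \<delta> (f y) = 0" for j \<delta>
  proof -
    define F where "F s = sesq (A j) \<delta> (f (s *s y))" for s
    \<comment> \<open>The partner point. Its parameters a, b, e are treated as independent, so that
      boundedness follows from continuity on a compact set. The triples used are (a, 1 / s, 1) and
      (a, 0, 0), where e is the product b s.\<close>
    define X where "X a b e = mk (cnj a *s \<omega> + cnj b *s \<delta>)
        (\<chi> j. cnj (2 * a * sesq (A j) \<omega> V + 2 * e * sesq (A j) \<delta> V))" for a b e :: complex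
    \<comment> \<open>For norm s at least 2 one has norm a at most 2 and norm (1 / s) at most
      1.\<close>
    define D where "D = cball (0::complex) 2 \<times> cball (0::complex) 1 \<times> cball (0::complex) 1"
    have bnd: "\<exists>G>0. \<forall>x\<in>D. norm (\<phi> x) \<le> G" if "continuous_on D \<phi>" for \<phi> :: "complex \<times> complex \<times> complex \<Rightarrow> complex"
    proof -
      have "bounded (\<phi> ` D)"
        unfolding D_def
        by (intro compact_imp_bounded compact_continuous_image that[unfolded D_def] compact_Times compact_cball)
      then show ?thesis
        unfolding bounded_pos by auto
    qed
    have cX: "continuous_on D (\<lambda>x. h c (X (fst x) (fst (snd x)) (snd (snd x))))" for c
      by (rule continuous_on_compose2[OF cont])
         (auto simp: X_def vector_scalar_mult_def intro!: continuous_intros)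
    obtain G1 where G1: "G1 > 0" "\<forall>x\<in>D. norm (g j (X (fst x) (fst (snd x)) (snd (snd x)))) \<le> G1"
      using bnd[OF cX[of "Inr j"]] by blast
    have "continuous_on D (\<lambda>x. sesq (A j) V (f (X (fst x) (fst (snd x)) (snd (snd x)))))"
      unfolding f_def by (intro continuous_intros cX)
    from bnd[OF this] obtain G2 where G2: "G2 > 0"
      "\<forall>x\<in>D. norm (sesq (A j) V (f (X (fst x) (fst (snd x)) (snd (snd x))))) \<le> G2"
      by blast
    have "\<forall>i. \<exists>C. \<forall>x. norm x \<le> norm y \<longrightarrow> norm (h (Inl i) x) \<le> C * norm x ^ 3"
      using growth by blast
    then obtain C where C: "\<And>i x. norm x \<le> norm y \<Longrightarrow> norm (h (Inl i) x) \<le> C i * norm x ^ 3"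
      by metis
    have "F 1 = 0"
    proof (rule entire_growth_eq_0[of F])
      have "(\<lambda>s. h c (s *s y)) holomorphic_on UNIV" for c
        by (rule hol) (auto intro!: holomorphic_intros)
      then show "F holomorphic_on UNIV"
        unfolding F_def f_def sesq_expand by (auto intro!: holomorphic_intros)
    next
      fix s :: complex assume s: "2 \<le> norm s"
      \<comment> \<open>chosen such that the constraint of the polarized identity becomes a + s = a s\<close>
      define a where "a = s / (s - 1)"
      have s1: "s \<noteq> 0" "s \<noteq> 1" using s by auto
      have a: "a + s = a * s" using s1 by (simp add: a_def field_simps)
      have "norm s \<le> 2 * norm (s - 1)"
        using s norm_triangle_ineq2[of s 1] by simp
      then have "norm a \<le> 2"
        using s1 by (simp add: a_def norm_divide field_simps)
      moreover have "1 / norm s \<le> 1"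
        using s by (simp add: divide_le_eq_1)
      ultimately have D: "(a, 1 / s, 1) \<in> D" "(a, 0, 0) \<in> D"
        by (auto simp: D_def norm_divide)
      have 1: "g j (s *s y) + cnj (g j (X a (1 / s) 1))
          = 2 * sesq (A j) (cnj a *s \<omega> + cnj (1 / s) *s \<delta>) (f (s *s y))
            + 2 * cnj (sesq (A j) (s *s V) (f (X a (1 / s) 1)))"
        unfolding y X_def
      proof (rule polarized)
        fix j
        have "2 * s * sesq (A j) \<omega> V + 2 * a * sesq (A j) \<omega> V = 2 * (a * s) * sesq (A j) \<omega> V"
          unfolding a[symmetric] by (simp add: algebra_simps)
        then show "(\<chi> j. 2 * s * sesq (A j) \<omega> V) $ j
            + cnj ((\<chi> j. cnj (2 * a * sesq (A j) \<omega> V + 2 * 1 * sesq (A j) \<delta> V)) $ j) =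
            2 * sesq (A j) (cnj a *s \<omega> + cnj (1 / s) *s \<delta>) (s *s V)"
          using s1 by (simp add: sesq_add_left sesq_smult_left sesq_smult_right algebra_simps)
      qed
      have 2: "g j (s *s y) + cnj (g j (X a 0 0))
          = 2 * sesq (A j) (cnj a *s \<omega> + cnj 0 *s \<delta>) (f (s *s y))
            + 2 * cnj (sesq (A j) (s *s V) (f (X a 0 0)))"
        unfolding y X_def
      proof (rule polarized)
        fix j
        have "2 * s * sesq (A j) \<omega> V + 2 * a * sesq (A j) \<omega> V = 2 * (a * s) * sesq (A j) \<omega> V"
          unfolding a[symmetric] by (simp add: algebra_simps)
        then show "(\<chi> j. 2 * s * sesq (A j) \<omega> V) $ j
            + cnj ((\<chi> j. cnj (2 * a * sesq (A j) \<omega> V + 2 * 0 * sesq (A j) \<delta> V)) $ j) =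
            2 * sesq (A j) (cnj a *s \<omega> + cnj 0 *s \<delta>) (s *s V)"
          by (simp add: sesq_add_left sesq_smult_left sesq_smult_right algebra_simps)
      qed
      \<comment> \<open>The difference of the two identities; pairing with s V produces the second
        factor s of the growth bound.\<close>
      have "2 * (1 / s * F s) = cnj (g j (X a (1 / s) 1)) - cnj (g j (X a 0 0))
          - 2 * (s * cnj (sesq (A j) V (f (X a (1 / s) 1))) - s * cnj (sesq (A j) V (f (X a 0 0))))"
        using arg_cong2[OF 1 2, of minus]
        by (simp add: F_def sesq_add_left sesq_smult_left sesq_smult_right right_diff_distrib)
      then have F: "F s = s * ((cnj (g j (X a (1 / s) 1)) - cnj (g j (X a 0 0))) / 2
          - s * (cnj (sesq (A j) V (f (X a (1 / s) 1))) - cnj (sesq (A j) V (f (X a 0 0)))))"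
        using s1 by (simp add: field_simps)
      have "norm ((cnj (g j (X a (1 / s) 1)) - cnj (g j (X a 0 0))) / 2) \<le> G1"
        using norm_triangle_ineq4[of "cnj (g j (X a (1 / s) 1))" "cnj (g j (X a 0 0))"]
          bspec[OF G1(2) D(1)] bspec[OF G1(2) D(2)] by (simp add: norm_divide)
      moreover have "norm (s * (cnj (sesq (A j) V (f (X a (1 / s) 1))) - cnj (sesq (A j) V (f (X a 0 0)))))
          \<le> norm s * (2 * G2)"
        unfolding norm_mult
        using norm_triangle_ineq4[of "cnj (sesq (A j) V (f (X a (1 / s) 1)))" "cnj (sesq (A j) V (f (X a 0 0)))"]
          bspec[OF G2(2) D(1)] bspec[OF G2(2) D(2)] by (intro mult_left_mono) (simp_all only: fst_conv snd_conv complex_mod_cnj norm_ge_zero)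
      ultimately have "norm (F s) \<le> norm s * (G1 + norm s * (2 * G2))"
        unfolding F norm_mult by (intro mult_left_mono order_trans[OF norm_triangle_ineq4] add_mono)
          (auto simp: norm_mult)
      also have "\<dots> \<le> norm s * (norm s * G1 + norm s * (2 * G2))"
        using s G1(1) by (intro mult_left_mono add_right_mono) auto
      finally show "norm (F s) \<le> (G1 + 2 * G2) * norm s ^ 2"
        by (simp add: power2_eq_square algebra_simps)
    next
      fix s :: complex assume s: "norm s < 1"
      have ny: "norm (s *s y) \<le> norm y"
        unfolding norm_smult_cart using s by (simp add: mult_left_le_one_le)
      have "norm (F s) \<le> (\<Sum>i\<in>UNIV. \<Sum>k\<in>UNIV. norm (\<delta> $ i) * (norm (A j $ i $ k) * (C k * norm (s *s y) ^ 3)))"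
        unfolding F_def sesq_expand f_def
        by (intro sum_norm_le) (auto simp: norm_mult intro!: mult_left_mono C ny)
      also have "\<dots> = (\<Sum>i\<in>UNIV. \<Sum>k\<in>UNIV. norm (\<delta> $ i) * (norm (A j $ i $ k) * (C k * norm y ^ 3))) * norm s ^ Suc 2"
        by (simp add: norm_smult_cart sum_distrib_left sum_distrib_right power_mult_distrib mult_ac
            eval_nat_numeral)
      finally show "norm (F s) \<le> (\<Sum>i\<in>UNIV. \<Sum>k\<in>UNIV. norm (\<delta> $ i) * (norm (A j $ i $ k) * (C k * norm y ^ 3))) * norm s ^ Suc 2" .
    qed auto
    then show ?thesis by (simp add: F_def)
  qed
  \<comment> \<open>Unit vectors as \<delta> read off the entries.\<close>
  have "A j *v f y = 0" for j
  proof -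
    have "(A j *v f y) $ i = 0" for i
      using zero[of j "axis i 1"] by (simp add: sesq_def axis_def if_distrib if_distribR cong: if_cong)
    then show ?thesis by (simp add: vec_eq_iff)
  qed
  then show ?thesis using kernel unfolding y_def by blast
qed

text \<open>Independent vectors \<open>A j *v V0\<close> are the rows of a matrix with a right
  inverse P. The conjugate appears because \<open>sesq\<close> is antilinear on the left: the
  conjugate of P y is a vector \<omega> solving \<omega>^* A_j V0 = y_j.\<close>

lemma independent_imp_onto:
  assumes "\<And>c. (\<Sum>j\<in>UNIV. c j *s (A j *v V0)) = 0 \<Longrightarrow> \<forall>j. c j = 0"
  shows "\<exists>P :: complex^'d^'n. \<forall>y j. sesq (A j) (\<chi> i. cnj ((P *v y) $ i)) V0 = y $ j"
proof -
  define Q :: "complex^'n^'d" where "Q = (\<chi> j. A j *v V0)"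
  have "\<exists>P. Q ** P = mat 1"
    unfolding matrix_right_invertible_independent_rows
    using assms by (simp add: Q_def row_def)
  then obtain P where P: "Q ** P = mat 1" ..
  show ?thesis
  proof (intro exI allI)
    fix y j
    have "(Q *v x) $ j = (\<Sum>i\<in>UNIV. x $ i * (A j *v V0) $ i)" for x
      unfolding matrix_vector_mult_def[of Q] by (simp add: Q_def mult.commute)
    then have "sesq (A j) (\<chi> i. cnj ((P *v y) $ i)) V0 = (Q *v (P *v y)) $ j"
      by (simp add: sesq_def)
    then show "sesq (A j) (\<chi> i. cnj ((P *v y) $ i)) V0 = y $ j"
      by (simp add: matrix_vector_mul_assoc P)
  qed
qed

text \<open>The discs reach all points (V, w) over a fixed V once \<omega>^* A_j V can take
  arbitrary values, an open condition along a complex line starting at V0. After f = 0 the polarized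
  identity relates only values of g.\<close>

lemma field_eq_0:
  assumes growth: "\<And>i K. \<exists>C. \<forall>x. norm x \<le> K \<longrightarrow> norm (h (Inl i) x) \<le> C * norm x ^ 3"
    and kernel: "\<And>v. (\<And>j. A j *v v = 0) \<Longrightarrow> v = 0"
    and ind: "\<And>c. (\<Sum>j\<in>UNIV. c j *s (A j *v V0)) = 0 \<Longrightarrow> \<forall>j. c j = 0"
    and g0: "\<And>j. g j 0 = 0"
  shows "h c x = 0"
proof -
  obtain P :: "complex^'d^'n" where P: "\<And>y j. sesq (A j) (\<chi> i. cnj ((P *v y) $ i)) V0 = y $ j"
    using independent_imp_onto[OF ind] by blast
  have f0: "f (mk V w) = 0" for V w
  proof -
    define U where "U l = V0 + l *s (V - V0)" for l
    \<comment> \<open>The matrix sending y to the values \<omega>^* A_j (U l), with \<omega> the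
      conjugate of P y. It is the identity at l = 0, so its determinant is nonzero nearby.\<close>
    define N where "N l = (\<chi> j k. \<Sum>i\<in>UNIV. P $ i $ k * (A j *v U l) $ i)" for l
    have N: "(N l *v y) $ j = sesq (A j) (\<chi> i. cnj ((P *v y) $ i)) (U l)" for l y j
    proof -
      have "(N l *v y) $ j = (\<Sum>k\<in>UNIV. \<Sum>i\<in>UNIV. P $ i $ k * (A j *v U l) $ i * y $ k)"
        by (simp add: N_def matrix_vector_mult_def[of "vec_lambda _"] sum_distrib_right)
      also have "\<dots> = (\<Sum>i\<in>UNIV. (\<Sum>k\<in>UNIV. P $ i $ k * y $ k) * (A j *v U l) $ i)"
        by (subst sum.swap) (simp add: sum_distrib_left sum_distrib_right mult_ac)
      finally show ?thesis
        by (simp add: sesq_def matrix_vector_mult_def[of P])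
    qed
    have "N 0 *v y = y" for y
      using P[of _ y] by (simp add: vec_eq_iff N U_def)
    then have N0: "N 0 = mat 1"
      by (simp add: matrix_eq)
    have "continuous_on UNIV (\<lambda>l. det (N l))"
      unfolding det_def N_def U_def matrix_vector_mult_def by (auto intro!: continuous_intros)
    then have "open {l. det (N l) \<noteq> 0}"
      by (intro open_Collect_neq continuous_on_const)
    then have ev: "\<forall>\<^sub>F l in nhds 0. det (N l) \<noteq> 0"
      by (rule eventually_nhds_in_open[THEN eventually_mono]) (auto simp: N0)
    \<comment> \<open>The discs are used only for l near 0; the identity theorem in l carries the
      zero to l = 1, where \<open>U l\<close> is V.\<close>
    have "h (Inl i) (mk (U 1) w) = 0" for i
    proof (rule entire_eq_0_if_eventually_0[of "\<lambda>l. h (Inl i) (mk (U l) w)"])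
      show "(\<lambda>l. h (Inl i) (mk (U l) w)) holomorphic_on UNIV"
      proof (rule hol)
        fix c show "(\<lambda>l. mk (U l) w $ c) holomorphic_on UNIV"
          by (cases c) (auto simp: U_def intro!: holomorphic_intros)
      qed
      show "\<forall>\<^sub>F l in nhds 0. h (Inl i) (mk (U l) w) = 0"
        using ev
      proof eventually_elim
        case (elim l)
        then have "invertible (N l)"
          by (simp add: invertible_det_nz)
        then obtain N' where N': "N l ** N' = mat 1"
          by (auto simp: invertible_def)
        \<comment> \<open>The discs have w = 2 \<omega>^* A V, hence the factor 1 / 2.\<close>
        define y where "y = N' *v ((1 / 2) *s w)"
        have "N l *v y = (1 / 2) *s w"
          by (simp add: y_def matrix_vector_mul_assoc N')
        then have "2 * sesq (A j) (\<chi> i. cnj ((P *v y) $ i)) (U l) = w $ j" for j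
          unfolding N[symmetric] by simp
        then have "f (mk (U l) w) = 0"
          using f_vanishes_on_discs[OF growth kernel, of "U l" "\<chi> i. cnj ((P *v y) $ i)"]
          by (simp add: vec_lambda_eta)
        then show ?case
          by (simp add: f_def vec_eq_iff)
      qed
    qed
    then show ?thesis by (simp add: f_def U_def vec_eq_iff)
  qed
  have g1: "g j (mk z w) = - cnj (g j (mk z' w'))" if "\<And>j. w $ j + cnj (w' $ j) = 2 * sesq (A j) z' z" for z w z' w' j
    using polarized[OF that, of j] by (simp add: f0 add_eq_0_iff2)
  \<comment> \<open>A partner with z' = 0 satisfies the constraint for every z, so g depends on w
    alone.\<close>
  have g2: "g j (mk z w) = g j (mk z'' w)" for z z'' w j
    using g1[of w "\<chi> j. - cnj (w $ j)" 0 z j] g1[of w "\<chi> j. - cnj (w $ j)" 0 z'' j] by simp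
  \<comment> \<open>Over V0 the partner can be chosen with w' = 0, which reduces g to its value at
    the origin.\<close>
  have g3: "g j (mk z w) = 0" for z w j
  proof -
    have "g j (mk V0 w) = - cnj (g j (mk (\<chi> i. cnj ((P *v ((1 / 2) *s w)) $ i)) 0))"
      by (rule g1) (simp add: P)
    then show ?thesis
      using g2[of j _ 0 0] g2[of j z w V0] g0 by simp
  qed
  show ?thesis
  proof (cases c)
    case (Inl i)
    then show ?thesis using f0[of "z_part x" "w_part x"] by (simp add: f_def vec_eq_iff)
  next
    case (Inr j)
    then show ?thesis using g3[of j "z_part x" "w_part x"] by simp
  qed
qed

end

section \<open>Remainders of weighted order three\<close>

lemma mvt_along:
  fixes R :: "'a::real_normed_vector \<Rightarrow> real"
  assumes "\<And>s. 0 \<le> s \<Longrightarrow> s \<le> 1 \<Longrightarrow> (R has_derivative D (y + s *\<^sub>R u)) (at (y + s *\<^sub>R u))"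
  shows "\<exists>s>0. s < 1 \<and> R (y + u) - R y = D (y + s *\<^sub>R u) u"
proof -
  have "((\<lambda>s. R (y + s *\<^sub>R u)) has_field_derivative D (y + s *\<^sub>R u) u) (at s)" if "0 \<le> s" "s \<le> 1" for s
  proof -
    have "((\<lambda>s. y + s *\<^sub>R u) has_derivative (\<lambda>c. c *\<^sub>R u)) (at s)"
      by (auto intro!: derivative_eq_intros)
    from has_derivative_compose[OF this assms[OF that]]
    have "((\<lambda>s. R (y + s *\<^sub>R u)) has_derivative (\<lambda>c. D (y + s *\<^sub>R u) (c *\<^sub>R u))) (at s)" .
    moreover have "D (y + s *\<^sub>R u) (c *\<^sub>R u) = D (y + s *\<^sub>R u) u * c" for c
      using has_derivative_linear[OF assms[OF that]] by (simp add: linear_scale)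
    ultimately show ?thesis
      by (simp add: has_field_derivative_def)
  qed
  from MVT2[of 0 1 "\<lambda>s. R (y + s *\<^sub>R u)", OF _ this] show ?thesis by auto
qed

text \<open>The weighted bound concerns only the values of R. From it and the differentiability
  class come the facts on derivatives that the blow-up needs: dR vanishes at 0, and so does the z-z
  block of the second derivative.\<close>

locale cubic_remainder =
  fixes R :: "'a::euclidean_space \<times> 'b::euclidean_space \<Rightarrow> real" and S k
  assumes S: "open S" "0 \<in> S" and C2: "class_C_on k R S" "k \<ge> 2"
    and O3: "R \<in> O[nhds 0](\<lambda>(z, v). (norm z + sqrt (norm v)) ^ 3)"
begin

definition D where "D y u = frechet_derivative R (at y) u"

lemma D: "y \<in> S \<Longrightarrow> (R has_derivative D y) (at y)"
proof -
  assume "y \<in> S"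
  then have "R differentiable (at y)"
    using C2 unfolding class_C_on_def by (auto dest: spec[of _ "[]"])
  then show ?thesis
    unfolding D_def by (simp add: frechet_derivative_works[symmetric])
qed

lemma linear_D: "y \<in> S \<Longrightarrow> linear (D y)"
  using D has_derivative_linear by blast

lemma D_differentiable: "y \<in> S \<Longrightarrow> (\<lambda>y. D y u) differentiable (at y)"
proof -
  assume "y \<in> S"
  moreover have "\<forall>x\<in>S. iterated_deriv [u] R differentiable (at x)"
    using C2 unfolding class_C_on_def by (metis (no_types) One_nat_def Suc_1 Suc_le_eq length_Cons list.size(3))
  ultimately show ?thesis by (simp add: D_def)
qed

lemma cubic_bound:
  obtains C where "C > 0" "\<forall>\<^sub>F y in nhds 0. \<bar>R y\<bar> \<le> C * (norm (fst y) + sqrt (norm (snd y))) ^ 3"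
proof -
  from landau_o.bigE[OF O3] obtain C where "C > 0"
    "\<forall>\<^sub>F y in nhds 0. norm (R y) \<le> C * norm (case y of (z, v) \<Rightarrow> (norm z + sqrt (norm v)) ^ 3)"
    by blast
  then show ?thesis
    by (intro that[of C]) (auto simp: case_prod_beta elim!: eventually_mono)
qed

lemma R_0: "R 0 = 0"
proof -
  obtain C where "\<forall>\<^sub>F y in nhds 0. \<bar>R y\<bar> \<le> C * (norm (fst y) + sqrt (norm (snd y))) ^ 3"
    using cubic_bound by blast
  from eventually_nhds_x_imp_x[OF this] show ?thesis by simp
qed

lemma weighted_line: "((\<lambda>t. (t *\<^sub>R z, t\<^sup>2 *\<^sub>R v)) \<longlongrightarrow> 0) (at_right (0::real))" for z :: 'a and v :: 'b
proof -
  have "((\<lambda>t. (t *\<^sub>R z, t\<^sup>2 *\<^sub>R v)) \<longlongrightarrow> (0 *\<^sub>R z, 0\<^sup>2 *\<^sub>R v)) (at_right (0::real))"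
    by (intro tendsto_intros)
  then show ?thesis by (simp add: zero_prod_def)
qed

lemma cubic_bound_along:
  obtains M where "\<forall>\<^sub>F t in at_right 0. \<bar>R (t *\<^sub>R z, t\<^sup>2 *\<^sub>R v)\<bar> \<le> M * t ^ 3"
proof -
  obtain C where C: "\<forall>\<^sub>F y in nhds 0. \<bar>R y\<bar> \<le> C * (norm (fst y) + sqrt (norm (snd y))) ^ 3"
    using cubic_bound by blast
  have "\<forall>\<^sub>F t in at_right 0. \<bar>R (t *\<^sub>R z, t\<^sup>2 *\<^sub>R v)\<bar> \<le> (C * (norm z + sqrt (norm v)) ^ 3) * t ^ 3"
    using eventually_compose_filterlim[OF C weighted_line[of z v]] eventually_at_right_less[of 0]
  proof eventually_elim
    case (elim t)
    then have "norm (t *\<^sub>R z) + sqrt (norm (t\<^sup>2 *\<^sub>R v)) = t * (norm z + sqrt (norm v))"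
      by (simp add: real_sqrt_mult algebra_simps)
    then show ?case
      using elim by (simp add: power_mult_distrib mult_ac)
  qed
  then show ?thesis by (rule that)
qed

text \<open>Along the ray t u the weighted size is O(sqrt t), because v has weight 2; hence R is
  O(t^(3/2)), which is o(t).\<close>

lemma D_0: "D 0 u = 0"
proof -
  obtain z v where u: "u = (z, v)" by (cases u)
  obtain C where C: "\<forall>\<^sub>F y in nhds 0. \<bar>R y\<bar> \<le> C * (norm (fst y) + sqrt (norm (snd y))) ^ 3"
    using cubic_bound by blast
  have "((\<lambda>t. t *\<^sub>R u) \<longlongrightarrow> 0) (at_right 0)"
    by (auto intro!: tendsto_eq_intros)
  note 1 = eventually_compose_filterlim[OF C this]
  have "((\<lambda>t. R (0 + t *\<^sub>R u) ) has_real_derivative D 0 u) (at 0)"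
  proof -
    have "((\<lambda>s. 0 + s *\<^sub>R u) has_derivative (\<lambda>c. c *\<^sub>R u)) (at 0)"
      by (auto intro!: derivative_eq_intros)
    moreover have "(R has_derivative D 0) (at (0 + 0 *\<^sub>R u))"
      using D[OF S(2)] by simp
    ultimately have "((\<lambda>s. R (0 + s *\<^sub>R u)) has_derivative (\<lambda>c. D 0 (c *\<^sub>R u))) (at 0)"
      by (rule has_derivative_compose)
    then show ?thesis
      using linear_D[OF S(2)] by (simp add: has_field_derivative_def linear_scale mult_commute_abs)
  qed
  then have "((\<lambda>t. R (t *\<^sub>R u) / t) \<longlongrightarrow> D 0 u) (at 0)"
    by (simp add: has_field_derivative_iff R_0)
  then have lim: "((\<lambda>t. R (t *\<^sub>R u) / t) \<longlongrightarrow> D 0 u) (at_right 0)"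
    by (rule tendsto_mono[OF at_le, rotated]) simp
  have "((\<lambda>t. R (t *\<^sub>R u) / t) \<longlongrightarrow> 0) (at_right 0)"
  proof (rule Lim_null_comparison)
    show "\<forall>\<^sub>F t in at_right 0. norm (R (t *\<^sub>R u) / t) \<le> C * (sqrt t * norm z + sqrt (norm v)) ^ 3 * sqrt t"
      using 1 eventually_at_right_less[of 0]
    proof eventually_elim
      case (elim t)
      have s: "t = sqrt t * sqrt t" using elim by simp
      have "norm (t *\<^sub>R z) + sqrt (norm (t *\<^sub>R v)) = sqrt t * (sqrt t * norm z + sqrt (norm v))"
        using elim by (simp add: real_sqrt_mult algebra_simps)
      then have "norm (R (t *\<^sub>R u)) \<le> C * (sqrt t ^ 3 * (sqrt t * norm z + sqrt (norm v)) ^ 3)"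
        using elim(1) by (simp add: u power_mult_distrib)
      also have "sqrt t ^ 3 = t * sqrt t"
        using elim(2) by (simp add: eval_nat_numeral)
      finally have "norm (R (t *\<^sub>R u)) \<le> t * (C * (sqrt t * norm z + sqrt (norm v)) ^ 3 * sqrt t)"
        by (simp add: mult_ac)
      then show ?case
        using elim(2) by (simp add: divide_le_eq mult_ac)
    qed
    have "((\<lambda>t. C * (sqrt t * norm z + sqrt (norm v)) ^ 3 * sqrt t) \<longlongrightarrow>
        C * (sqrt 0 * norm z + sqrt (norm v)) ^ 3 * sqrt 0) (at_right 0)"
      by (intro tendsto_intros)
    then show "((\<lambda>t. C * (sqrt t * norm z + sqrt (norm v)) ^ 3 * sqrt t) \<longlongrightarrow> 0) (at_right 0)"
      by simp
  qed
  from tendsto_unique[OF _ lim this] show ?thesis by simp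
qed

definition D2 where "D2 u = frechet_derivative (\<lambda>y. D y u) (at 0)"

lemma D2: "((\<lambda>y. D y u) has_derivative D2 u) (at 0)"
  unfolding D2_def using D_differentiable[OF S(2)] frechet_derivative_works by blast

lemma D2_bound:
  assumes "e > 0"
  obtains d where "d > 0" "\<And>y. norm y < d \<Longrightarrow> y \<in> S \<and> \<bar>D y u - D2 u y\<bar> \<le> e * norm y"
proof -
  obtain d where d: "d > 0" "\<And>y. norm (y - 0) < d \<Longrightarrow> norm (D y u - D 0 u - D2 u (y - 0)) \<le> e * norm (y - 0)"
    using has_derivative_at_alt[THEN iffD1, OF D2[of u]] assms by blast
  obtain d' where "d' > 0" "ball 0 d' \<subseteq> S"
    using S open_contains_ball by blast
  then show ?thesis
    using d by (intro that[of "min d d'"]) (auto simp: D_0 subset_iff)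
qed

text \<open>Compare the increment of R from t z to t z + t e a, which is O(t^3), with the mean value
  theorem and the first-order expansion of D.\<close>

lemma D2_0: "D2 (a, 0) (z, 0) = 0"
proof -
  obtain C where C: "C > 0" "\<forall>\<^sub>F y in nhds 0. \<bar>R y\<bar> \<le> C * (norm (fst y) + sqrt (norm (snd y))) ^ 3"
    using cubic_bound by blast
  then obtain d0 where d0: "d0 > 0" "\<And>y. norm y < d0 \<Longrightarrow> \<bar>R y\<bar> \<le> C * (norm (fst y) + sqrt (norm (snd y))) ^ 3"
    unfolding eventually_nhds_metric by auto
  \<comment> \<open>All points used have norm at most t N. Their v-part is 0, so the weighted size
    is the norm and R is O((t N)^3) there.\<close>
  define N where "N = norm a + norm z + 1"
  have N: "N > 0" by (auto simp: N_def add_nonneg_pos)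
  have main: "\<bar>D2 (a, 0) (z, 0)\<bar> \<le> e * (\<bar>D2 (a, 0) (a, 0)\<bar> + N + 2 * C * N ^ 3)" if e: "0 < e" "e \<le> 1" for e
  proof -
    obtain d where d: "d > 0" "\<And>y. norm y < d \<Longrightarrow> y \<in> S \<and> \<bar>D y (a, 0) - D2 (a, 0) y\<bar> \<le> e * norm y"
      using D2_bound[OF e(1)] by metis
    \<comment> \<open>The bound \<open>e * e\<close> gives t / e \<le> e, so an increment of size
      t^3 divided by the step t e is at most t times a multiple of e.\<close>
    define t where "t = min (e * e) (min d d0 / (2 * N))"
    have t: "t > 0" "t \<le> e * e" "t * N < d" "t * N < d0"
    proof -
      show "t > 0" "t \<le> e * e" using e d(1) d0(1) N by (auto simp: t_def)
      have "t \<le> min d d0 / (2 * N)" by (simp add: t_def)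
      then have "t * N \<le> min d d0 / 2" using N by (simp add: field_simps)
      then show "t * N < d" "t * N < d0" using d(1) d0(1) by auto
    qed
    let ?y = "(t *\<^sub>R z, 0::'b)" and ?u = "(t * e) *\<^sub>R (a, 0::'b)"
    have n: "norm (?y + s *\<^sub>R ?u) \<le> t * N" if "0 \<le> s" "s \<le> 1" for s
    proof -
      have "norm (?y + s *\<^sub>R ?u) = norm (t *\<^sub>R z + (s * t * e) *\<^sub>R a)"
        by (simp add: norm_Pair mult.assoc)
      also have "\<dots> \<le> t * norm z + (s * t * e) * norm a"
        using norm_triangle_ineq[of "t *\<^sub>R z" "(s * t * e) *\<^sub>R a"] that t(1) e by simp
      also have "s * t * e \<le> 1 * t * 1"
        using that t(1) e by (intro mult_mono) auto
      then have "(s * t * e) * norm a \<le> t * norm a"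
        by (intro mult_right_mono) auto
      finally show ?thesis using t(1) by (simp add: N_def algebra_simps)
    qed
    have b: "\<bar>R (?y + s *\<^sub>R ?u)\<bar> \<le> C * (t * N) ^ 3" if "0 \<le> s" "s \<le> 1" for s
    proof -
      have "\<bar>R (?y + s *\<^sub>R ?u)\<bar> \<le> C * (norm (fst (?y + s *\<^sub>R ?u)) + sqrt (norm (snd (?y + s *\<^sub>R ?u)))) ^ 3"
        using n[OF that] t by (intro d0) auto
      also have "\<dots> = C * norm (?y + s *\<^sub>R ?u) ^ 3"
        by (simp add: norm_Pair)
      also have "\<dots> \<le> C * (t * N) ^ 3"
        using C(1) n[OF that] by (intro mult_left_mono power_mono) auto
      finally show ?thesis .
    qed
    have "\<exists>s>0. s < 1 \<and> R (?y + ?u) - R ?y = D (?y + s *\<^sub>R ?u) ?u"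
    proof (rule mvt_along, rule D)
      fix s :: real assume "0 \<le> s" "s \<le> 1"
      from n[OF this] t show "?y + s *\<^sub>R ?u \<in> S" using d(2) by auto
    qed
    then obtain s where s: "0 < s" "s < 1" "R (?y + ?u) - R ?y = D (?y + s *\<^sub>R ?u) ?u"
      by blast
    define \<xi> where "\<xi> = ?y + s *\<^sub>R ?u"
    have \<xi>: "norm \<xi> \<le> t * N" "\<xi> \<in> S" "\<bar>D \<xi> (a, 0) - D2 (a, 0) \<xi>\<bar> \<le> e * norm \<xi>"
      using n[of s] s t d(2)[of \<xi>] by (auto simp: \<xi>_def)
    have lin2: "linear (D2 (a, 0))"
      using D2 has_derivative_linear by blast
    have "\<xi> = t *\<^sub>R (z, 0) + (s * t * e) *\<^sub>R (a, 0)"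
      by (simp add: \<xi>_def)
    then have "D2 (a, 0) \<xi> = t * D2 (a, 0) (z, 0) + s * t * e * D2 (a, 0) (a, 0)"
      using lin2 by (simp add: linear_add linear_scale del: scaleR_Pair add_Pair)
    moreover have D\<xi>: "D \<xi> ?u = t * e * D \<xi> (a, 0)"
      using linear_D[OF \<xi>(2)] by (simp add: linear_scale del: scaleR_Pair)
    have "t * e * \<bar>D \<xi> (a, 0)\<bar> = \<bar>R (?y + ?u) - R ?y\<bar>"
      unfolding s(3) \<xi>_def[symmetric] D\<xi> using t(1) e by (simp add: abs_mult)
    then have "t * e * \<bar>D \<xi> (a, 0)\<bar> \<le> 2 * C * (t * N) ^ 3"
      using b[of 0] b[of 1] by simp
    then have "t * e * \<bar>D \<xi> (a, 0)\<bar> \<le> t * e * (t * (2 * C * N ^ 3 * t / e))"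
      using e by (simp add: eval_nat_numeral mult_ac)
    then have "\<bar>D \<xi> (a, 0)\<bar> \<le> t * (2 * C * N ^ 3 * t / e)"
      by (rule mult_left_le_imp_le) (use t(1) e in auto)
    moreover have "t / e \<le> e"
      using t(2) e by (simp add: divide_le_eq)
    then have "(2 * C * N ^ 3) * (t / e) \<le> (2 * C * N ^ 3) * e"
      using C(1) N by (intro mult_left_mono) auto
    then have "t * (2 * C * N ^ 3 * t / e) \<le> t * ((2 * C * N ^ 3) * e)"
      using t(1) by (intro mult_left_mono) auto
    moreover have "\<bar>D2 (a, 0) \<xi>\<bar> \<le> \<bar>D \<xi> (a, 0)\<bar> + e * (t * N)"
      using \<xi>(1,3) e mult_left_mono[OF \<xi>(1), of e] by linarith
    moreover have "\<bar>t * D2 (a, 0) (z, 0)\<bar> \<le> \<bar>t * D2 (a, 0) (z, 0) + s * t * e * D2 (a, 0) (a, 0)\<bar>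
        + \<bar>s * t * e * D2 (a, 0) (a, 0)\<bar>"
      by linarith
    moreover have "\<bar>s * t * e * D2 (a, 0) (a, 0)\<bar> \<le> t * (e * \<bar>D2 (a, 0) (a, 0)\<bar>)"
      using s t(1) e mult_right_mono[of s 1 "t * (e * \<bar>D2 (a, 0) (a, 0)\<bar>)"] by (simp add: abs_mult mult_ac)
    ultimately have "\<bar>t * D2 (a, 0) (z, 0)\<bar> \<le> t * ((2 * C * N ^ 3) * e) + e * (t * N) + t * (e * \<bar>D2 (a, 0) (a, 0)\<bar>)"
      by linarith
    also have "\<dots> = t * (e * (\<bar>D2 (a, 0) (a, 0)\<bar> + N + 2 * C * N ^ 3))"
      by (simp add: algebra_simps)
    finally show ?thesis
      using t(1) by (simp add: abs_mult)
  qed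
  have "((\<lambda>e. e * (\<bar>D2 (a, 0) (a, 0)\<bar> + N + 2 * C * N ^ 3)) \<longlongrightarrow> 0 * (\<bar>D2 (a, 0) (a, 0)\<bar> + N + 2 * C * N ^ 3)) (at_right 0)"
    by (intro tendsto_intros)
  moreover have "\<forall>\<^sub>F e in at_right 0. \<bar>D2 (a, 0) (z, 0)\<bar> \<le> e * (\<bar>D2 (a, 0) (a, 0)\<bar> + N + 2 * C * N ^ 3)"
    using eventually_at_right_real[OF zero_less_one] by eventually_elim (use main in auto)
  ultimately have "\<bar>D2 (a, 0) (z, 0)\<bar> \<le> 0 * (\<bar>D2 (a, 0) (a, 0)\<bar> + N + 2 * C * N ^ 3)"
    by (intro tendsto_lowerbound) auto
  then show ?thesis by simp
qed

text \<open>Where z = O(t) and v = O(t^2), this makes the z-derivative of R o(t) and the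
  v-derivative o(1). The z-derivative is linear up to a small error, and by \<open>D2_0\<close> the
  linear part sees only v.\<close>

lemma D_bound:
  assumes "e > 0"
  obtains d K where "d > 0" "K \<ge> 0" "\<And>y. norm y < d \<Longrightarrow> y \<in> S"
    "\<And>y u. norm y < d \<Longrightarrow> \<bar>D y u\<bar> \<le> (e * norm (fst y) + K * norm (snd y)) * norm (fst u) + e * norm (snd u)"
proof -
  \<comment> \<open>Divided by the dimensions because the estimates for basis vectors are
    summed.\<close>
  define e' where "e' = e / (DIM('a) + DIM('b))"
  have e': "e' > 0" "DIM('a) * e' \<le> e" "DIM('b) * e' \<le> e"
    using assms by (auto simp: e'_def field_simps add_pos_pos intro!: mult_left_mono)
  define K where "K a = onorm (D2 (a, 0)) + e'" for a
  have K: "K a \<ge> 0" for a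
    using e'(1) onorm_pos_le[OF has_derivative_bounded_linear[OF D2]] by (simp add: K_def add_nonneg_nonneg)
  have a: "\<forall>\<^sub>F y in nhds 0. \<bar>D y (a, 0)\<bar> \<le> e' * norm (fst y) + K a * norm (snd y)" for a
  proof -
    obtain d where d: "d > 0" "\<And>y. norm y < d \<Longrightarrow> y \<in> S \<and> \<bar>D y (a, 0) - D2 (a, 0) y\<bar> \<le> e' * norm y"
      using D2_bound[OF e'(1)] by metis
    have "\<bar>D y (a, 0)\<bar> \<le> e' * norm (fst y) + K a * norm (snd y)" if y: "norm y < d" for y
    proof -
      obtain z v where zv: "y = (z, v)" by (cases y)
      have "D2 (a, 0) y = D2 (a, 0) (z, 0) + D2 (a, 0) (0, v)"
        using linear_add[OF has_derivative_linear[OF D2], of "(a, 0)" "(z, 0)" "(0, v)"] by (simp add: zv)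
      then have "\<bar>D2 (a, 0) y\<bar> \<le> onorm (D2 (a, 0)) * norm (snd y)"
        using onorm[OF has_derivative_bounded_linear[OF D2], of "(a, 0)" "(0, v)"] by (simp add: D2_0 zv)
      moreover have "e' * norm y \<le> e' * (norm (fst y) + norm (snd y))"
        using e'(1) norm_Pair_le[of "fst y" "snd y"] by (intro mult_left_mono) auto
      ultimately show ?thesis
        using d(2)[OF y] unfolding K_def distrib_left distrib_right by linarith
    qed
    then show ?thesis
      using d(1) by (auto simp: eventually_nhds_metric)
  qed
  have b: "\<forall>\<^sub>F y in nhds 0. \<bar>D y (0, b)\<bar> \<le> e'" for b
  proof -
    have "((\<lambda>y. D y (0, b)) \<longlongrightarrow> D 0 (0, b)) (nhds 0)"
      using has_derivative_continuous[OF D2, of "(0, b)"] by (simp add: isCont_def tendsto_nhds_iff)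
    then have "\<forall>\<^sub>F y in nhds 0. dist (D y (0, b)) (D 0 (0, b)) < e'"
      using e'(1) tendstoD by blast
    then show ?thesis
      by eventually_elim (simp add: D_0 dist_norm)
  qed
  have "\<forall>\<^sub>F y in nhds 0. y \<in> S \<and> (\<forall>a\<in>Basis. \<bar>D y (a, 0)\<bar> \<le> e' * norm (fst y) + K a * norm (snd y))
      \<and> (\<forall>b\<in>Basis. \<bar>D y (0, b)\<bar> \<le> e')"
    using a b S by (intro eventually_conj eventually_ball_finite eventually_nhds_in_open) auto
  then obtain d where d: "d > 0" "\<And>y. norm y < d \<Longrightarrow> y \<in> S \<and>
      (\<forall>a\<in>Basis. \<bar>D y (a, 0)\<bar> \<le> e' * norm (fst y) + K a * norm (snd y)) \<and> (\<forall>b\<in>Basis. \<bar>D y (0, b)\<bar> \<le> e')"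
    unfolding eventually_nhds_metric by auto
  show ?thesis
  proof (rule that[of d "\<Sum>a\<in>Basis. K a"])
    show "(\<Sum>a\<in>Basis. K a) \<ge> 0" using K by (intro sum_nonneg) auto
    fix y :: "'a \<times> 'b" and u :: "'a \<times> 'b" assume y: "norm y < d"
    have lin: "linear (D y)" using linear_D d(2)[OF y] by blast
    have "u = (\<Sum>a\<in>Basis. (fst u \<bullet> a) *\<^sub>R (a, 0)) + (\<Sum>b\<in>Basis. (snd u \<bullet> b) *\<^sub>R (0, b))"
      by (rule prod_eqI) (simp_all add: fst_sum snd_sum euclidean_representation)
    then have "D y u = D y ((\<Sum>a\<in>Basis. (fst u \<bullet> a) *\<^sub>R (a, 0)) + (\<Sum>b\<in>Basis. (snd u \<bullet> b) *\<^sub>R (0, b)))"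
      by simp
    also have "\<dots> = (\<Sum>a\<in>Basis. (fst u \<bullet> a) * D y (a, 0)) + (\<Sum>b\<in>Basis. (snd u \<bullet> b) * D y (0, b))"
      using lin by (simp add: linear_add linear_sum linear_scale del: scaleR_Pair)
    finally have "\<bar>D y u\<bar> \<le> \<bar>\<Sum>a\<in>Basis. (fst u \<bullet> a) * D y (a, 0)\<bar> + \<bar>\<Sum>b\<in>Basis. (snd u \<bullet> b) * D y (0, b)\<bar>"
      by simp
    also have "\<bar>\<Sum>a\<in>Basis. (fst u \<bullet> a) * D y (a, 0)\<bar>
        \<le> (\<Sum>a\<in>Basis. norm (fst u) * (e' * norm (fst y) + K a * norm (snd y)))"
      using d(2)[OF y] by (intro order_trans[OF sum_abs] sum_mono)
        (auto simp: abs_mult intro!: mult_mono Basis_le_norm)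
    also have "\<dots> = (DIM('a) * e' * norm (fst y) + (\<Sum>a\<in>Basis. K a) * norm (snd y)) * norm (fst u)"
      by (simp add: sum.distrib sum_distrib_left sum_distrib_right algebra_simps)
    also have "\<dots> \<le> (e * norm (fst y) + (\<Sum>a\<in>Basis. K a) * norm (snd y)) * norm (fst u)"
      using e' by (intro mult_right_mono add_right_mono) auto
    also have "\<bar>\<Sum>b\<in>Basis. (snd u \<bullet> b) * D y (0, b)\<bar> \<le> (\<Sum>b\<in>(Basis::'b set). norm (snd u) * e')"
      using d(2)[OF y] by (intro order_trans[OF sum_abs] sum_mono)
        (auto simp: abs_mult intro!: mult_mono Basis_le_norm)
    also have "\<dots> \<le> e * norm (snd u)"
      using mult_right_mono[OF e'(3), of "norm (snd u)"] by (simp add: mult_ac)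
    finally show "\<bar>D y u\<bar> \<le> (e * norm (fst y) + (\<Sum>a\<in>Basis. K a) * norm (snd y)) * norm (fst u) + e * norm (snd u)"
      by simp
  qed (use d in auto)
qed

text \<open>By the mean value theorem a displacement of weights (a, a + 1) changes R by o(t) t^a +
  o(1) t^(a + 1). The condition on a keeps the whole segment at weighted size O(t).\<close>

lemma weighted_increment:
  assumes F: "(F \<longlongrightarrow> f) (at_right 0)" and G: "(G \<longlongrightarrow> g) (at_right 0)" and a: "a \<ge> 1"
  shows "((\<lambda>t. (R (t *\<^sub>R z + t ^ a *\<^sub>R F t, t\<^sup>2 *\<^sub>R v + t ^ Suc a *\<^sub>R G t) - R (t *\<^sub>R z, t\<^sup>2 *\<^sub>R v)) / t ^ Suc a) \<longlongrightarrow> 0)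
    (at_right 0)"
proof (rule tendstoI)
  fix \<epsilon> :: real assume "\<epsilon> > 0"
  define M where "M = max (norm f) (norm g) + norm z + norm v + 1"
  have M: "M > 0" by (auto simp: M_def le_max_iff_disj intro!: add_nonneg_pos add_nonneg_nonneg)
  \<comment> \<open>The e-terms take one half of \<epsilon>; the term with K carries a spare factor
    t and takes the other half.\<close>
  define e where "e = \<epsilon> / (4 * (2 * M * M + M))"
  have e: "e > 0" "e * (2 * M * M + M) < \<epsilon> / 2"
    using \<open>\<epsilon> > 0\<close> M by (auto simp: e_def field_simps add_pos_pos)
  obtain d K where d: "d > 0" "K \<ge> 0" "\<And>y. norm y < d \<Longrightarrow> y \<in> S"
    "\<And>y u. norm y < d \<Longrightarrow> \<bar>D y u\<bar> \<le> (e * norm (fst y) + K * norm (snd y)) * norm (fst u) + e * norm (snd u)"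
    using D_bound[OF e(1)] by metis
  have "norm f < M" "norm g < M" "norm z \<le> M" "norm v \<le> M"
    unfolding M_def by (smt (verit) norm_ge_zero)+
  note zv = this(3,4)
  have "\<forall>\<^sub>F t in at_right 0. norm (F t) < M" "\<forall>\<^sub>F t in at_right 0. norm (G t) < M"
    using order_tendstoD(2)[OF tendsto_norm[OF F], of M] order_tendstoD(2)[OF tendsto_norm[OF G], of M]
      \<open>norm f < M\<close> \<open>norm g < M\<close> by auto
  moreover have "\<forall>\<^sub>F t in at_right 0. t * (4 * M) < d" 
  proof (rule order_tendstoD(2)[of _ "0 * (4 * M)"])
    show "((\<lambda>t. t * (4 * M)) \<longlongrightarrow> 0 * (4 * M)) (at_right 0)" by (intro tendsto_intros)
  qed (use d in auto)
  moreover have "\<forall>\<^sub>F t in at_right 0. t * (K * 2 * M * M) < \<epsilon> / 2" 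
  proof (rule order_tendstoD(2)[of _ "0 * (K * 2 * M * M)"])
    show "((\<lambda>t. t * (K * 2 * M * M)) \<longlongrightarrow> 0 * (K * 2 * M * M)) (at_right 0)" by (intro tendsto_intros)
  qed (use \<open>\<epsilon> > 0\<close> in auto)
  moreover note eventually_at_right_real[OF zero_less_one]
  ultimately show "\<forall>\<^sub>F t in at_right 0. dist ((R (t *\<^sub>R z + t ^ a *\<^sub>R F t, t\<^sup>2 *\<^sub>R v + t ^ Suc a *\<^sub>R G t)
      - R (t *\<^sub>R z, t\<^sup>2 *\<^sub>R v)) / t ^ Suc a) 0 < \<epsilon>"
  proof eventually_elim
    case (elim t)
    let ?y = "(t *\<^sub>R z, t\<^sup>2 *\<^sub>R v)" and ?u = "(t ^ a *\<^sub>R F t, t ^ Suc a *\<^sub>R G t)"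
    have t: "0 < t" "t < 1" using elim by auto
    have ta: "t ^ a \<le> t" "t ^ Suc a \<le> t\<^sup>2"
      using power_decreasing[of 1 a t] power_decreasing[of 2 "Suc a" t] t a by auto
    have n: "norm (fst (?y + s *\<^sub>R ?u)) \<le> t * (2 * M)" "norm (snd (?y + s *\<^sub>R ?u)) \<le> t\<^sup>2 * (2 * M)"
      if "0 \<le> s" "s \<le> 1" for s
    proof -
      have "norm (t *\<^sub>R z + (s * t ^ a) *\<^sub>R F t) \<le> t * norm z + s * t ^ a * norm (F t)"
        using norm_triangle_ineq[of "t *\<^sub>R z" "(s * t ^ a) *\<^sub>R F t"] t that by simp
      also have "s * t ^ a \<le> 1 * t" using that ta t by (intro mult_mono) auto
      then have "s * t ^ a * norm (F t) \<le> t * M" using elim t that by (intro mult_mono) auto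
      finally have "norm (t *\<^sub>R z + (s * t ^ a) *\<^sub>R F t) \<le> t * M + t * M"
        using mult_left_mono[OF zv(1), of t] t(1) by linarith
      then show "norm (fst (?y + s *\<^sub>R ?u)) \<le> t * (2 * M)"
        by (simp add: mult_ac)
      have "norm (t\<^sup>2 *\<^sub>R v + (s * t ^ Suc a) *\<^sub>R G t) \<le> t\<^sup>2 * norm v + s * t ^ Suc a * norm (G t)"
        using norm_triangle_ineq[of "t\<^sup>2 *\<^sub>R v" "(s * t ^ Suc a) *\<^sub>R G t"] t that by simp
      also have "s * t ^ Suc a \<le> 1 * t\<^sup>2" using that ta t by (intro mult_mono) auto
      then have "s * t ^ Suc a * norm (G t) \<le> t\<^sup>2 * M" using elim t that by (intro mult_mono) auto
      finally have "norm (t\<^sup>2 *\<^sub>R v + (s * t ^ Suc a) *\<^sub>R G t) \<le> t\<^sup>2 * M + t\<^sup>2 * M"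
        using mult_left_mono[OF zv(2), of "t\<^sup>2"] t(1) by (smt (verit) zero_le_power2)
      then show "norm (snd (?y + s *\<^sub>R ?u)) \<le> t\<^sup>2 * (2 * M)"
        by (simp add: mult_ac)
    qed
    have n': "norm (?y + s *\<^sub>R ?u) < d" if "0 \<le> s" "s \<le> 1" for s
    proof -
      have "norm (?y + s *\<^sub>R ?u) \<le> t * (2 * M) + t\<^sup>2 * (2 * M)"
        using n[OF that] norm_Pair_le[of "fst (?y + s *\<^sub>R ?u)" "snd (?y + s *\<^sub>R ?u)"]
        unfolding prod.collapse by linarith
      also have "t\<^sup>2 * (2 * M) \<le> t * (2 * M)"
        using t M by (intro mult_right_mono) (auto simp: power2_eq_square)
      finally show ?thesis using elim(3) by linarith
    qed
    have "\<exists>s>0. s < 1 \<and> R (?y + ?u) - R ?y = D (?y + s *\<^sub>R ?u) ?u"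
      by (rule mvt_along, rule D, rule d(3), rule n')
    then obtain s where s: "0 \<le> s" "s \<le> 1" "R (?y + ?u) - R ?y = D (?y + s *\<^sub>R ?u) ?u"
      by (auto intro: less_imp_le)
    have "\<bar>R (?y + ?u) - R ?y\<bar> \<le> (e * norm (fst (?y + s *\<^sub>R ?u)) + K * norm (snd (?y + s *\<^sub>R ?u))) * norm (fst ?u)
        + e * norm (snd ?u)"
      unfolding s(3) by (rule d(4)[OF n'[OF s(1,2)]])
    also have "\<dots> \<le> (e * (t * (2 * M)) + K * (t\<^sup>2 * (2 * M))) * (t ^ a * M) + e * (t ^ Suc a * M)"
      using n[OF s(1,2)] e d(2) t M elim
      by (intro add_mono mult_mono) (auto intro!: add_nonneg_nonneg mult_nonneg_nonneg)
    also have "\<dots> = t ^ Suc a * (e * (2 * M * M + M) + t * (K * 2 * M * M))"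
      by (simp add: algebra_simps power2_eq_square)
    also have "\<dots> < t ^ Suc a * \<epsilon>"
      using e(2) elim t by (intro mult_strict_left_mono) auto
    finally show ?case
      using t by (simp add: dist_norm field_simps)
  qed
qed

end

section \<open>Blow-up to the quadric\<close>

definition wgt :: "'n + 'd \<Rightarrow> nat" where
  "wgt c = (case c of Inl _ \<Rightarrow> 1 | Inr _ \<Rightarrow> 2)"

lemma wgt_simps [simp]: "wgt (Inl i) = 1" "wgt (Inr j) = 2"
  by (simp_all add: wgt_def)

lemma scaleR_smult: "c *\<^sub>R a = complex_of_real c *s a"
  by (simp add: vec_eq_iff) (simp add: scaleR_conv_of_real)

lemma sesq_scaleR:
  "sesq A (c *\<^sub>R a) b = c *\<^sub>R sesq A a b" "sesq A a (c *\<^sub>R b) = c *\<^sub>R sesq A a b"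
  unfolding scaleR_smult sesq_smult_left sesq_smult_right by (simp_all add: scaleR_conv_of_real)

lemma tendsto_sesq [tendsto_intros]:
  "(F \<longlongrightarrow> f) X \<Longrightarrow> (G \<longlongrightarrow> g) X \<Longrightarrow> ((\<lambda>t. sesq A (F t) (G t)) \<longlongrightarrow> sesq A f g) X"
  unfolding sesq_expand by (intro tendsto_intros)

lemma tendsto_mk [tendsto_intros]:
  assumes "(F \<longlongrightarrow> f) X" "(G \<longlongrightarrow> g) X"
  shows "((\<lambda>t. mk (F t) (G t)) \<longlongrightarrow> mk f g) X"
  unfolding mk_def
proof (rule tendsto_vec_lambda)
  fix c show "((\<lambda>x. case c of Inl i \<Rightarrow> F x $ i | Inr j \<Rightarrow> G x $ j) \<longlongrightarrow>
    (case c of Inl i \<Rightarrow> f $ i | Inr j \<Rightarrow> g $ j)) X"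
    using assms by (cases c) (auto intro!: tendsto_intros)
qed

text \<open>The map y + h(y) in normal coordinates. The bound \<open>h3\<close> is isotropic, as it
  comes from the 2-jet; weighted orders are derived from it.\<close>

locale normal_form_map =
  fixes A :: "'d::finite \<Rightarrow> complex^'n::finite^'n" and R :: "'d \<Rightarrow> (complex^'n) \<times> (real^'d) \<Rightarrow> real"
    and S k and h :: "'n + 'd \<Rightarrow> complex^('n + 'd) \<Rightarrow> complex" and r B C \<rho> :: real
  assumes herm: "\<And>j. hermitian (A j)"
    and R: "\<And>j. cubic_remainder (R j) S k"
    and h: "\<And>c. bounded_holo wgt (h c) r B"
    and h3: "\<And>c x. x \<in> ball 0 r \<Longrightarrow> norm (h c x) \<le> C * norm x ^ 3"
    and \<rho>: "\<rho> > 0"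
    and maps: "\<And>y. norm y < \<rho> \<Longrightarrow>
      (\<And>j. Re (w_part y $ j) = Re (sesq (A j) (z_part y) (z_part y)) - R j (z_part y, \<chi> i. Im (w_part y $ i))) \<Longrightarrow>
      y' = y + (\<chi> c. h c y) \<Longrightarrow>
      Re (w_part y' $ j) = Re (sesq (A j) (z_part y') (z_part y')) - R j (z_part y', \<chi> i. Im (w_part y' $ i))"
begin

text \<open>The equation of M is written at the images of dilated points near x and divided by t^(a
  + 1). The mixed term 2 Re z^* A_j f survives; the term quadratic in f has order t^(2 a), and the
  increment of R is o(t^(a + 1)).\<close>

lemma leading_tangent:
  assumes a: "a \<ge> 2"
    and Zf: "\<And>i x m. m < a \<Longrightarrow> wcoef wgt (h (Inl i)) m x = 0"
    and Zg: "\<And>j x m. m < Suc a \<Longrightarrow> wcoef wgt (h (Inr j)) m x = 0"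
    and quad: "\<And>j. Re (w_part x $ j) = Re (sesq (A j) (z_part x) (z_part x))"
  shows "Re (wcoef wgt (h (Inr j)) (Suc a) x) =
    2 * Re (sesq (A j) (z_part x) (\<chi> i. wcoef wgt (h (Inl i)) a x))"
proof -
  define z where "z = z_part x"
  define w where "w = w_part x"
  define v where "v = (\<chi> i. Im (w $ i))"
  define q where "q j t = R j (t *\<^sub>R z, t\<^sup>2 *\<^sub>R v)" for j t
  \<comment> \<open>Subtracting R / t^2 from w puts the dilated point exactly on M. The correction
    is O(t), so \<open>X t\<close> tends to x.\<close>
  define X where "X t = mk z (\<chi> j. w $ j - of_real (q j t / t\<^sup>2))" for t
  define Y where "Y t = dil wgt (of_real t) (X t)" for t :: real
  have q: "((\<lambda>t. q j t / t\<^sup>2) \<longlongrightarrow> 0) (at_right 0)" for j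
  proof -
    interpret cubic_remainder "R j" S k by (rule R)
    obtain M where M: "\<forall>\<^sub>F t in at_right 0. \<bar>R j (t *\<^sub>R z, t\<^sup>2 *\<^sub>R v)\<bar> \<le> M * t ^ 3"
      by (rule cubic_bound_along[of z v])
    show ?thesis
    proof (rule Lim_null_comparison)
      show "\<forall>\<^sub>F t in at_right 0. norm (q j t / t\<^sup>2) \<le> M * t"
        using M eventually_at_right_less[of 0]
      proof eventually_elim
        case (elim t)
        then have "\<bar>q j t\<bar> / t\<^sup>2 \<le> M * t ^ 3 / t\<^sup>2"
          unfolding q_def by (intro divide_right_mono) auto
        also have "\<dots> = M * t"
          using elim by (simp add: eval_nat_numeral)
        finally show ?case by simp
      qed
      have "((\<lambda>t. M * t) \<longlongrightarrow> M * 0) (at_right 0)" by (intro tendsto_intros)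
      then show "((\<lambda>t. M * t) \<longlongrightarrow> 0) (at_right 0)" by simp
    qed
  qed
  have "(X \<longlongrightarrow> mk z (\<chi> j. w $ j - of_real 0)) (at_right 0)"
    unfolding X_def by (intro tendsto_intros q)
  then have X: "(X \<longlongrightarrow> x) (at_right 0)"
    by (simp add: vec_nth_inverse z_def w_def vec_lambda_eta)
  define F where "F t = (\<chi> i. h (Inl i) (Y t) / of_real t ^ a)" for t
  define G where "G t = (\<chi> j. h (Inr j) (Y t) / of_real t ^ Suc a)" for t
  have F: "(F \<longlongrightarrow> (\<chi> i. wcoef wgt (h (Inl i)) a x)) (at_right 0)"
    unfolding F_def Y_def
    by (intro tendsto_vec_lambda bounded_holo.wcoef_limit[OF h Zf X])
  have G: "(G \<longlongrightarrow> (\<chi> j. wcoef wgt (h (Inr j)) (Suc a) x)) (at_right 0)"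
    unfolding G_def Y_def
    by (intro tendsto_vec_lambda bounded_holo.wcoef_limit[OF h Zg X])
  have Y0: "(Y \<longlongrightarrow> 0) (at_right 0)"
  proof (rule Lim_null_comparison)
    show "\<forall>\<^sub>F t in at_right 0. norm (Y t) \<le> t * norm (X t)"
      using eventually_at_right_real[OF zero_less_one]
    proof eventually_elim
      case (elim t)
      have "norm (Y t) \<le> norm (complex_of_real t) * norm (X t)"
        unfolding Y_def by (rule norm_dil_le) (use elim in \<open>auto simp: wgt_def split: sum.split\<close>)
      then show ?case using elim by simp
    qed
    have "((\<lambda>t. t * norm (X t)) \<longlongrightarrow> 0 * norm x) (at_right 0)" by (intro tendsto_intros X)
    then show "((\<lambda>t. t * norm (X t)) \<longlongrightarrow> 0) (at_right 0)" by simp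
  qed
  define \<Delta> where "\<Delta> t = (R j (t *\<^sub>R z + t ^ a *\<^sub>R F t, t\<^sup>2 *\<^sub>R v + t ^ Suc a *\<^sub>R (\<chi> i. Im (G t $ i)))
      - R j (t *\<^sub>R z, t\<^sup>2 *\<^sub>R v)) / t ^ Suc a" for t
  have \<Delta>: "(\<Delta> \<longlongrightarrow> 0) (at_right 0)"
    unfolding \<Delta>_def
  proof (rule cubic_remainder.weighted_increment[OF R F])
    show "((\<lambda>t. \<chi> i. Im (G t $ i)) \<longlongrightarrow> (\<chi> i. Im ((\<chi> j. wcoef wgt (h (Inr j)) (Suc a) x) $ i))) (at_right 0)"
      by (intro tendsto_intros G)
  qed (use a in simp)
  have "\<forall>\<^sub>F t in at_right 0. norm (Y t) < \<rho>"
    using order_tendstoD(2)[OF tendsto_norm[OF Y0], of \<rho>] \<rho> by simp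
  then have eq: "\<forall>\<^sub>F t in at_right 0. Re (G t $ j) =
      2 * Re (sesq (A j) z (F t)) + t ^ (a - 1) * Re (sesq (A j) (F t) (F t)) - \<Delta> t"
    using eventually_at_right_less[of 0]
  proof eventually_elim
    case (elim t)
    have t: "t > 0" using elim by simp
    have zY: "z_part (Y t) = t *\<^sub>R z"
      by (simp add: z_part_def Y_def X_def dil_def vec_eq_iff scaleR_smult)
    have wY: "w_part (Y t) $ l = of_real (t\<^sup>2) * w $ l - of_real (q l t)" for l
      using t by (simp add: w_part_def Y_def X_def dil_def field_simps)
    have ImY: "(\<chi> i. Im (w_part (Y t) $ i)) = t\<^sup>2 *\<^sub>R v"
      by (simp add: wY v_def vec_eq_iff)
    have onM: "Re (w_part (Y t) $ l) = Re (sesq (A l) (z_part (Y t)) (z_part (Y t)))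
        - R l (z_part (Y t), \<chi> i. Im (w_part (Y t) $ i))" for l
      using quad[of l] unfolding ImY zY
      by (simp add: wY q_def w_def z_def sesq_scaleR power2_eq_square)
    define y' where "y' = Y t + (\<chi> c. h c (Y t))"
    have zy': "z_part y' = t *\<^sub>R z + t ^ a *\<^sub>R F t"
      using t unfolding zY[symmetric]
      by (simp add: y'_def z_part_def F_def vec_eq_iff scaleR_smult)
    have wy': "w_part y' $ l = w_part (Y t) $ l + of_real (t ^ Suc a) * G t $ l" for l
      using t by (simp add: y'_def w_part_def G_def)
    have Imy': "(\<chi> i. Im (w_part y' $ i)) = t\<^sup>2 *\<^sub>R v + t ^ Suc a *\<^sub>R (\<chi> i. Im (G t $ i))"
      unfolding ImY[symmetric] by (simp add: wy' vec_eq_iff del: of_real_power power_Suc)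
    have "Re (w_part y' $ j) = Re (sesq (A j) (z_part y') (z_part y')) - R j (z_part y', \<chi> i. Im (w_part y' $ i))"
      by (rule maps[OF _ onM y'_def]) (use elim in simp)
    then have 1: "Re (w_part (Y t) $ j) + t ^ Suc a * Re (G t $ j) =
        Re (sesq (A j) (t *\<^sub>R z + t ^ a *\<^sub>R F t) (t *\<^sub>R z + t ^ a *\<^sub>R F t))
        - R j (t *\<^sub>R z + t ^ a *\<^sub>R F t, t\<^sup>2 *\<^sub>R v + t ^ Suc a *\<^sub>R (\<chi> i. Im (G t $ i)))"
      unfolding Imy' by (simp add: zy' wy' del: of_real_power power_Suc)
    have 2: "Re (sesq (A j) (t *\<^sub>R z + t ^ a *\<^sub>R F t) (t *\<^sub>R z + t ^ a *\<^sub>R F t)) =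
        Re (sesq (A j) (t *\<^sub>R z) (t *\<^sub>R z)) + t ^ Suc a * (2 * Re (sesq (A j) z (F t)))
        + t ^ a * t ^ a * Re (sesq (A j) (F t) (F t))"
    proof -
      have "Re (sesq (A j) (F t) z) = Re (sesq (A j) z (F t))"
        using cnj_sesq[OF herm, of j z "F t", symmetric] by simp
      then show ?thesis
        by (simp add: sesq_scaleR sesq_add_left sesq_add_right algebra_simps)
    qed
    \<comment> \<open>The exponent a - 1 is positive, so the quadratic term disappears in the
      limit.\<close>
    have ta: "t ^ a * t ^ a = t ^ Suc a * t ^ (a - 1)"
    proof -
      have "a + a = Suc a + (a - 1)" using a by simp
      then show ?thesis by (simp only: power_add[symmetric])
    qed
    have "t ^ Suc a * \<Delta> t = R j (t *\<^sub>R z + t ^ a *\<^sub>R F t, t\<^sup>2 *\<^sub>R v + t ^ Suc a *\<^sub>R (\<chi> i. Im (G t $ i)))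
      - R j (t *\<^sub>R z, t\<^sup>2 *\<^sub>R v)"
      using t by (simp add: \<Delta>_def del: power_Suc)
    with 1 2 onM[of j] have "t ^ Suc a * Re (G t $ j) =
        t ^ Suc a * (2 * Re (sesq (A j) z (F t))) + t ^ a * t ^ a * Re (sesq (A j) (F t) (F t)) - t ^ Suc a * \<Delta> t"
      unfolding ImY zY by linarith
    also have "\<dots> = t ^ Suc a * (2 * Re (sesq (A j) z (F t)) + t ^ (a - 1) * Re (sesq (A j) (F t) (F t)) - \<Delta> t)"
      unfolding ta by (simp add: algebra_simps)
    finally show ?case
      using t by simp
  qed
  let ?f = "\<chi> i. wcoef wgt (h (Inl i)) a x"
  have "((\<lambda>t. 2 * Re (sesq (A j) z (F t)) + t ^ (a - 1) * Re (sesq (A j) (F t) (F t)) - \<Delta> t) \<longlongrightarrow>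
      2 * Re (sesq (A j) z ?f) + 0 ^ (a - 1) * Re (sesq (A j) ?f ?f) - 0) (at_right 0)"
    by (intro tendsto_intros F \<Delta>)
  then have "((\<lambda>t. Re (G t $ j)) \<longlongrightarrow> 2 * Re (sesq (A j) z ?f) + 0 ^ (a - 1) * Re (sesq (A j) ?f ?f) - 0) (at_right 0)"
    by (subst tendsto_cong[OF eq])
  from tendsto_unique[OF _ _ this] have "Re ((\<chi> j. wcoef wgt (h (Inr j)) (Suc a) x) $ j) =
      2 * Re (sesq (A j) z ?f) + 0 ^ (a - 1) * Re (sesq (A j) ?f ?f) - 0"
    if "((\<lambda>t. Re (G t $ j)) \<longlongrightarrow> Re ((\<chi> j. wcoef wgt (h (Inr j)) (Suc a) x) $ j)) (at_right 0)"
    using that by simp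
  moreover have "((\<lambda>t. Re (G t $ j)) \<longlongrightarrow> Re ((\<chi> j. wcoef wgt (h (Inr j)) (Suc a) x) $ j)) (at_right 0)"
    by (intro tendsto_intros G)
  ultimately show ?thesis
    using a by (simp add: z_def power_0_left)
qed

lemma C_nonneg: "C \<ge> 0"
proof -
  have r: "r > 0" using bounded_holo.r[OF h] .
  obtain x :: "complex^('n + 'd)" where x: "norm x = r / 2"
    using vector_choose_size[of "r / 2"] r by auto
  have "0 \<le> norm (h undefined x)" by simp
  also have "\<dots> \<le> C * norm x ^ 3" by (rule h3) (use x r in simp)
  finally have "0 \<le> C * (r / 2) ^ 3" by (simp only: x)
  then show ?thesis
    using r by (meson half_gt_zero linorder_not_less mult_neg_pos zero_less_power)
qed

text \<open>Induction on the weighted order; the orders of f and g are offset by one since tangency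
  pairs f with a factor z. Cubic contact removes all orders below 3, which gives the start a =
  2.\<close>

lemma wcoef_vanish:
  assumes kernel: "\<And>v. (\<And>j. A j *v v = 0) \<Longrightarrow> v = 0"
    and ind: "\<And>c. (\<Sum>j\<in>UNIV. c j *s (A j *v V0)) = 0 \<Longrightarrow> \<forall>j. c j = 0"
    and "a \<ge> 2"
  shows "(\<forall>i x m. m < a \<longrightarrow> wcoef wgt (h (Inl i)) m x = 0) \<and>
    (\<forall>j x m. m < Suc a \<longrightarrow> wcoef wgt (h (Inr j)) m x = 0)"
  using \<open>a \<ge> 2\<close>
proof (induction a rule: dec_induct)
  case base
  have "wcoef wgt (h c) m x = 0" if "m < 3" for c m x
    using bounded_holo.wcoef_eq_0[OF h h3 C_nonneg that] .
  then show ?case by simp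
next
  case (step a)
  then have Zf: "\<And>i x m. m < a \<Longrightarrow> wcoef wgt (h (Inl i)) m x = 0"
    and Zg: "\<And>j x m. m < Suc a \<Longrightarrow> wcoef wgt (h (Inr j)) m x = 0"
    by auto
  define ord where "ord c = (case c of Inl (_::'n) \<Rightarrow> a | Inr (_::'d) \<Rightarrow> Suc a)" for c
  define H where "H c = wcoef wgt (h c) (ord c)" for c
  have Z: "m < ord c \<Longrightarrow> wcoef wgt (h c) m x = 0" for m c x
    using Zf Zg by (cases c) (auto simp: ord_def)
  interpret quadric_field A H
  proof
    show "hermitian (A j)" for j by (rule herm)
    show "continuous_on UNIV (H c)" for c
      unfolding H_def by (rule bounded_holo.continuous_wcoef[OF h Z])
    show "(\<lambda>s. H c (\<gamma> s)) holomorphic_on UNIV"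
      if "\<And>i. (\<lambda>s. \<gamma> s $ i) holomorphic_on UNIV" for \<gamma> c
      unfolding H_def by (rule bounded_holo.wcoef_comp_curve[OF h Z that])
    show "Re (H (Inr j) x) = 2 * Re (sesq (A j) (z_part x) (\<chi> i. H (Inl i) x))"
      if "\<And>j. Re (w_part x $ j) = Re (sesq (A j) (z_part x) (z_part x))" for x j
      using leading_tangent[OF step(1) Zf Zg that] by (simp add: H_def ord_def)
  qed
  have growth: "\<exists>D. \<forall>x. norm x \<le> K \<longrightarrow> norm (H c x) \<le> D * norm x ^ 3" for c K
    unfolding H_def using bounded_holo.wcoef_bound_power[OF h h3 C_nonneg] by blast
  have "H (Inr j) 0 = 0" for j
  proof -
    obtain D where "\<forall>x. norm x \<le> 0 \<longrightarrow> norm (H (Inr j) x) \<le> D * norm x ^ 3"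
      using growth[of 0] by blast
    from this[rule_format, of 0] show ?thesis by simp
  qed
  from field_eq_0[OF growth kernel ind this] have "H c x = 0" for c x .
  then have "wcoef wgt (h (Inl i)) a x = 0" "wcoef wgt (h (Inr j)) (Suc a) x = 0" for i j x
    unfolding H_def ord_def by (metis sum.case(1), metis sum.case(2))
  then show ?case
    using Zf Zg by (auto simp: less_Suc_eq)
qed

lemma eventually_0:
  assumes kernel: "\<And>v. (\<And>j. A j *v v = 0) \<Longrightarrow> v = 0"
    and ind: "\<And>c. (\<Sum>j\<in>UNIV. c j *s (A j *v V0)) = 0 \<Longrightarrow> \<forall>j. c j = 0"
  shows "\<forall>\<^sub>F x in nhds 0. h c x = 0"
proof (rule bounded_holo.eventually_0_if_wcoef_0[OF h])
  fix m x
  \<comment> \<open>The value m + 2 exceeds m and is at least the start of the induction.\<close>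
  show "wcoef wgt (h c) m x = 0"
    using wcoef_vanish[OF kernel ind, where a = "m + 2"] by (cases c) auto
qed

end

section \<open>Holomorphic maps and jets\<close>

lemma holo_component:
  assumes "holomorphic_map_on F U"
  shows "holo (\<lambda>x. F x $ c) U"
  unfolding holo_def
proof
  fix x assume "x \<in> U"
  then obtain L where L: "Vector_Spaces.linear (*s) (*s) L" "(F has_derivative L) (at x)"
    using assms unfolding holomorphic_map_on_def by blast
  have "((\<lambda>x. F x $ c) has_derivative (\<lambda>v. L v $ c)) (at x)"
    by (rule bounded_linear.has_derivative[OF bounded_linear_vec_nth L(2)])
  moreover have "L (a *s v) $ c = a * L v $ c" for a v
    using L(1) by (simp add: Vector_Spaces.linear_iff)
  ultimately show "\<exists>L. ((\<lambda>x. F x $ c) has_derivative L) (at x) \<and> (\<forall>a v. L (a *s v) = a * L v)"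
    by blast
qed

lemma holomorphic_map_on_subset: "holomorphic_map_on F U \<Longrightarrow> V \<subseteq> U \<Longrightarrow> holomorphic_map_on F V"
  by (auto simp: holomorphic_map_on_def)

lemma holomorphic_map_on_compose:
  assumes "holomorphic_map_on F U" "holomorphic_map_on G V" "\<And>x. x \<in> U \<Longrightarrow> F x \<in> V"
  shows "holomorphic_map_on (\<lambda>x. G (F x)) U"
  unfolding holomorphic_map_on_def
proof
  fix x assume x: "x \<in> U"
  then obtain L where L: "Vector_Spaces.linear (*s) (*s) L" "(F has_derivative L) (at x)"
    using assms unfolding holomorphic_map_on_def by blast
  obtain K where K: "Vector_Spaces.linear (*s) (*s) K" "(G has_derivative K) (at (F x))"
    using assms x unfolding holomorphic_map_on_def by blast
  have "Vector_Spaces.linear (*s) (*s) (K \<circ> L)"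
    using Vector_Spaces.linear_compose[OF L(1) K(1)] .
  then show "\<exists>L. Vector_Spaces.linear (*s) (*s) L \<and> ((\<lambda>x. G (F x)) has_derivative L) (at x)"
    using has_derivative_compose[OF L(2) K(2)] unfolding comp_def by blast
qed

lemma holomorphic_map_on_continuous: "holomorphic_map_on F U \<Longrightarrow> continuous_on U F"
  unfolding holomorphic_map_on_def
  by (meson continuous_at_imp_continuous_on has_derivative_continuous)

lemma norm_le_sum_components: "norm x \<le> (\<Sum>c\<in>UNIV. norm (x $ c))" for x :: "complex^'m"
  unfolding norm_vec_def by (rule L2_set_le_sum) simp

text \<open>Needed to push the cubic contact of F and G through coordinate changes. The radius r / 5
  below is the shrinking required by \<open>holo_Lipschitz\<close>.\<close>

lemma holomorphic_map_Lipschitz: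
  assumes "holomorphic_map_on F U" "open U" "a \<in> U"
  obtains r L where "r > 0" "L \<ge> 0" "\<And>x y. x \<in> ball a r \<Longrightarrow> y \<in> ball a r \<Longrightarrow> norm (F x - F y) \<le> L * norm (x - y)"
proof -
  have "\<forall>c. \<exists>r L. r > 0 \<and> (\<forall>x y. x \<in> ball a r \<longrightarrow> y \<in> ball a r \<longrightarrow> norm (F x $ c - F y $ c) \<le> L * norm (x - y))"
  proof
    fix c
    obtain r B where r: "r > 0" "ball a r \<subseteq> U" "\<And>x. x \<in> ball a r \<Longrightarrow> norm (F x $ c) \<le> B"
      using holo_locally_bounded[OF holo_component[OF assms(1)] assms(2,3)] by metis
    have "norm (F x $ c - F y $ c) \<le> B / (r / 5) * norm (x - y)" if "x \<in> ball a (r / 5)" "y \<in> ball a (r / 5)" for x y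
      using holo_subset[OF holo_component[OF assms(1)] r(2)] r that by (intro holo_Lipschitz[of "\<lambda>x. F x $ c"]) auto
    then show "\<exists>r L. r > 0 \<and> (\<forall>x y. x \<in> ball a r \<longrightarrow> y \<in> ball a r \<longrightarrow> norm (F x $ c - F y $ c) \<le> L * norm (x - y))"
      using r(1) by (intro exI[of _ "r / 5"] exI[of _ "B / (r / 5)"]) auto
  qed
  then obtain r L where rL: "\<And>c. r c > 0"
    "\<And>c x y. x \<in> ball a (r c) \<Longrightarrow> y \<in> ball a (r c) \<Longrightarrow> norm (F x $ c - F y $ c) \<le> L c * norm (x - y)"
    by metis
  define r0 where "r0 = Min (range r)"
  have r0: "r0 > 0" "r0 \<le> r c" for c
    using rL(1) by (auto simp: r0_def)
  show ?thesis
  proof (rule that[of r0 "\<bar>\<Sum>c\<in>UNIV. L c\<bar>"])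
    fix x y assume xy: "x \<in> ball a r0" "y \<in> ball a r0"
    have "norm (F x - F y) \<le> (\<Sum>c\<in>UNIV. norm (F x $ c - F y $ c))"
      using norm_le_sum_components[of "F x - F y"] by simp
    also have "\<dots> \<le> (\<Sum>c\<in>UNIV. L c * norm (x - y))"
    proof (intro sum_mono rL(2))
      fix c show "x \<in> ball a (r c)" "y \<in> ball a (r c)" using xy r0(2)[of c] by auto
    qed
    also have "\<dots> \<le> \<bar>\<Sum>c\<in>UNIV. L c\<bar> * norm (x - y)"
      unfolding sum_distrib_right[symmetric] by (intro mult_right_mono) auto
    finally show "norm (F x - F y) \<le> \<bar>\<Sum>c\<in>UNIV. L c\<bar> * norm (x - y)" .
  qed (use r0 in auto)
qed

lemma frechet_derivative_component:
  assumes "holomorphic_map_on F U" "x \<in> U"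
  shows "frechet_derivative F (at x) v $ c = frechet_derivative (\<lambda>x. F x $ c) (at x) v"
proof -
  obtain L where L: "(F has_derivative L) (at x)"
    using assms unfolding holomorphic_map_on_def by blast
  have "((\<lambda>x. F x $ c) has_derivative (\<lambda>v. L v $ c)) (at x)"
    by (rule bounded_linear.has_derivative[OF bounded_linear_vec_nth L])
  from frechet_derivative_at[OF this, symmetric] show ?thesis
    using frechet_derivative_at[OF L, symmetric] by simp
qed

lemma vec_differentiable_componentwise:
  fixes f :: "'a::real_normed_vector \<Rightarrow> complex^'m"
  assumes "\<And>c. (\<lambda>x. f x $ c) differentiable (at a)"
  shows "f differentiable (at a)"
proof -
  have "(\<lambda>x. \<Sum>c\<in>UNIV. axis c (f x $ c)) differentiable (at a)"
  proof (intro differentiable_sum ballI)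
    fix c
    obtain D where D: "((\<lambda>x. f x $ c) has_derivative D) (at a)"
      using assms unfolding differentiable_def by blast
    from bounded_linear.has_derivative[OF bounded_linear_axis D]
    show "(\<lambda>x. axis c (f x $ c)) differentiable (at a)"
      unfolding differentiable_def by blast
  qed simp
  moreover have "(\<lambda>x. \<Sum>c\<in>UNIV. axis c (f x $ c)) = f"
    by (auto simp: vec_eq_iff axis_def if_distrib cong: if_cong)
  ultimately show ?thesis by simp
qed

lemma directional_derivative_map_differentiable:
  assumes "holomorphic_map_on F U" "open U" "a \<in> U"
  shows "(\<lambda>x. frechet_derivative F (at x) v) differentiable (at a)"
proof (rule vec_differentiable_componentwise)
  fix c
  have "(\<lambda>x. frechet_derivative (\<lambda>x. F x $ c) (at x) v) differentiable (at a)"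
    by (rule holo_directional_derivative_differentiable[OF holo_component[OF assms(1)] assms(2,3)])
  then obtain D where D: "((\<lambda>x. frechet_derivative (\<lambda>x. F x $ c) (at x) v) has_derivative D) (at a)"
    unfolding differentiable_def by blast
  have "((\<lambda>x. frechet_derivative F (at x) v $ c) has_derivative D) (at a)"
    by (rule has_derivative_transform_within_open[OF D assms(2,3)])
       (simp add: frechet_derivative_component[OF assms(1)])
  then show "(\<lambda>x. frechet_derivative F (at x) v $ c) differentiable (at a)"
    unfolding differentiable_def by blast
qed

text \<open>Each x is reached at t = 1 on the complex line p + t v with v = x - p, along which F - G
  has zero 2-jet. The parameter disc has radius R = r / norm v, so the one-variable remainder of
  size (1 / R)^3 is the cubic bound, uniformly in the direction.\<close>

lemma same_jet_2_imp_cubic_contact: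
  assumes F: "holomorphic_map_on F U" and G: "holomorphic_map_on G U" and U: "open U" "p \<in> U"
    and jet: "same_jet 2 F G p"
  obtains r C where "r > 0" "C \<ge> 0" "\<And>x. x \<in> ball p r \<Longrightarrow> norm (F x - G x) \<le> C * norm (x - p) ^ 3"
proof -
  have jets: "F p = G p" "frechet_derivative F (at p) v = frechet_derivative G (at p) v"
    "frechet_derivative (\<lambda>x. frechet_derivative F (at x) v) (at p) v
      = frechet_derivative (\<lambda>x. frechet_derivative G (at x) v) (at p) v" for v
    using jet unfolding same_jet_def
    by (auto dest: spec[of _ "[]"] spec[of _ "[v]"] spec[of _ "[v, v]"])
  have "\<forall>c. \<exists>r C. r > 0 \<and> (\<forall>x. x \<in> ball p r \<longrightarrow> norm (F x $ c - G x $ c) \<le> C * norm (x - p) ^ 3)"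
  proof
    fix c
    define d where "d x = F x $ c - G x $ c" for x
    have d: "holo d U"
      unfolding d_def[abs_def] by (intro holo_diff holo_component F G)
    obtain r B where r: "r > 0" "ball p r \<subseteq> U" "\<And>x. x \<in> ball p r \<Longrightarrow> norm (d x) \<le> B"
      using holo_locally_bounded[OF d U] by metis
    have "norm (d x) \<le> 2 * B / r ^ 3 * norm (x - p) ^ 3" if x: "x \<in> ball p (r / 2)" for x
    proof (cases "x = p")
      case True
      then show ?thesis by (simp add: d_def jets)
    next
      case False
      define v where "v = x - p"
      define R where "R = r / norm v"
      define \<phi> where "\<phi> t = d (p + t *s v)" for t
      have v: "norm v > 0" "norm v < r / 2"
        using False x by (auto simp: v_def dist_norm norm_minus_commute)
      have R: "R > 0" "1 \<le> R / 2"
        using v r(1) by (auto simp: R_def field_simps)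
      have sub: "p + t *s v \<in> ball p r" if "norm t < R" for t
      proof -
        have "norm (t *s v) < r"
          unfolding norm_smult_cart using that v by (simp add: R_def field_simps)
        then show ?thesis by (simp add: dist_norm)
      qed
      have dr: "holo d (ball p r)" using holo_subset[OF d r(2)] .
      have \<phi>: "\<phi> holomorphic_on ball 0 R"
        unfolding \<phi>_def[abs_def] by (rule holo_line[OF dr sub])
      define E where "E y = frechet_derivative F (at y) v - frechet_derivative G (at y) v" for y
      have \<phi>': "(\<phi> has_field_derivative E (p + t *s v) $ c) (at t)" if "norm t < R" for t
      proof -
        have in_U: "p + t *s v \<in> U" using sub[OF that] r(2) by auto
        have "((\<lambda>x. F x $ c - G x $ c) has_derivative
            (\<lambda>u. frechet_derivative F (at (p + t *s v)) u $ c - frechet_derivative G (at (p + t *s v)) u $ c))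
            (at (p + t *s v))"
          unfolding frechet_derivative_component[OF F in_U] frechet_derivative_component[OF G in_U]
          by (intro has_derivative_diff frechet_holo(1)[OF holo_component[OF F] in_U]
              frechet_holo(1)[OF holo_component[OF G] in_U])
        from frechet_derivative_at[OF this, symmetric]
        have "frechet_derivative d (at (p + t *s v)) v = E (p + t *s v) $ c"
          unfolding d_def[abs_def] E_def by simp
        then show ?thesis
          using holo_line_has_field_derivative[OF dr sub[OF that]] by (simp add: \<phi>_def[abs_def])
      qed
      have "\<phi> 0 = 0" by (simp add: \<phi>_def d_def jets)
      moreover have d1: "deriv \<phi> t = E (p + t *s v) $ c" if "norm t < R" for t
        using DERIV_imp_deriv[OF \<phi>'[OF that]] .
      then have "deriv \<phi> 0 = 0"
        using R(1) by (simp add: E_def jets)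
      moreover have "deriv (deriv \<phi>) 0 = 0"
      proof -
        have "deriv \<phi> holomorphic_on ball 0 R"
          by (rule holomorphic_deriv[OF \<phi>]) simp
        then have "(deriv \<phi> has_field_derivative deriv (deriv \<phi>) 0) (at 0)"
          using R(1) by (intro holomorphic_derivI[of _ "ball 0 R"]) auto
        then have 1: "(deriv \<phi> has_derivative (\<lambda>t. deriv (deriv \<phi>) 0 * t)) (at 0)"
          by (simp add: has_field_derivative_def)
        define E' where "E' u = frechet_derivative (\<lambda>x. frechet_derivative F (at x) v) (at p) u
            - frechet_derivative (\<lambda>x. frechet_derivative G (at x) v) (at p) u" for u
        \<comment> \<open>\<open>frechet_derivative\<close> is a derivative only where one exists,
          so the directional derivatives must be known to be differentiable before the second-order
          jets say anything about \<open>deriv (deriv \<phi>)\<close>.\<close>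
        have E: "(E has_derivative E') (at p)"
          unfolding E_def[abs_def] E'_def[abs_def]
          using directional_derivative_map_differentiable[OF F U] directional_derivative_map_differentiable[OF G U]
          by (intro has_derivative_diff) (simp_all add: frechet_derivative_works)
        then have "(E has_derivative E') (at (p + 0 *s v))" by simp
        from has_derivative_compose[OF has_derivative_complex_line this]
        have "((\<lambda>t. E (p + t *s v)) has_derivative (\<lambda>t. E' (t *s v))) (at 0)" .
        from bounded_linear.has_derivative[OF bounded_linear_vec_nth this]
        have "((\<lambda>t. E (p + t *s v) $ c) has_derivative (\<lambda>t. E' (t *s v) $ c)) (at 0)" .
        then have "(deriv \<phi> has_derivative (\<lambda>t. E' (t *s v) $ c)) (at 0)"
          by (rule has_derivative_transform_within_open[of _ _ _ _ "ball 0 R"])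
             (use R(1) d1 in auto)
        from has_derivative_unique[OF 1 this]
        have "deriv (deriv \<phi>) 0 * 1 = E' (1 *s v) $ c" by (rule fun_cong)
        then show ?thesis by (simp add: E'_def jets)
      qed
      ultimately have "(\<Sum>i<3. (deriv ^^ i) \<phi> 0 / fact i * 1 ^ i) = 0"
        by (simp add: eval_nat_numeral)
      moreover have "norm (\<phi> 1 - (\<Sum>i<3. (deriv ^^ i) \<phi> 0 / fact i * 1 ^ i)) \<le> 2 * B * (norm (1::complex) / R) ^ 3"
        using R r(3) sub by (intro Taylor_remainder_bound \<phi>) (auto simp: \<phi>_def)
      ultimately show ?thesis
        by (simp add: \<phi>_def v_def R_def power_divide)
    qed
    then show "\<exists>r C. r > 0 \<and> (\<forall>x. x \<in> ball p r \<longrightarrow> norm (F x $ c - G x $ c) \<le> C * norm (x - p) ^ 3)"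
      unfolding d_def using r(1) by (intro exI[of _ "r / 2"] exI[of _ "2 * B / r ^ 3"]) auto
  qed
  then obtain r C where rC: "\<And>c. r c > 0"
    "\<And>c x. x \<in> ball p (r c) \<Longrightarrow> norm (F x $ c - G x $ c) \<le> C c * norm (x - p) ^ 3"
    by metis
  define r0 where "r0 = Min (range r)"
  have r0: "r0 > 0" "r0 \<le> r c" for c
    using rC(1) by (auto simp: r0_def)
  show ?thesis
  proof (rule that[of r0 "\<bar>\<Sum>c\<in>UNIV. C c\<bar>"])
    fix x assume x: "x \<in> ball p r0"
    have "norm (F x - G x) \<le> (\<Sum>c\<in>UNIV. norm (F x $ c - G x $ c))"
      using norm_le_sum_components[of "F x - G x"] by simp
    also have "\<dots> \<le> (\<Sum>c\<in>UNIV. C c * norm (x - p) ^ 3)"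
    proof (intro sum_mono rC(2))
      fix c show "x \<in> ball p (r c)" using x r0(2)[of c] by auto
    qed
    also have "\<dots> \<le> \<bar>\<Sum>c\<in>UNIV. C c\<bar> * norm (x - p) ^ 3"
      unfolding sum_distrib_right[symmetric] by (intro mult_right_mono) auto
    finally show "norm (F x - G x) \<le> \<bar>\<Sum>c\<in>UNIV. C c\<bar> * norm (x - p) ^ 3" .
  qed (use r0 in auto)
qed

section \<open>Reduction to normal coordinates\<close>

lemma biholomorphic_betweenD:
  assumes "biholomorphic_between F U V"
  shows "open U" "open V" "holomorphic_map_on F U" "holomorphic_map_on (inv_into U F) V"
    "\<And>x. x \<in> U \<Longrightarrow> F x \<in> V" "\<And>y. y \<in> V \<Longrightarrow> inv_into U F y \<in> U"
    "\<And>x. x \<in> U \<Longrightarrow> inv_into U F (F x) = x" "\<And>y. y \<in> V \<Longrightarrow> F (inv_into U F y) = y"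
  using assms unfolding biholomorphic_between_def
  by (auto simp: bij_betw_apply bij_betw_inv_into_left bij_betw_inv_into_right
      dest: bij_betw_inv_into bij_betwE)

lemma holomorphic_map_on_tendsto:
  assumes "holomorphic_map_on F U" "open U" "a \<in> U"
  shows "(F \<longlongrightarrow> F a) (nhds a)"
  using holomorphic_map_on_continuous[OF assms(1)] assms(2,3)
  by (auto simp: continuous_on_eq_continuous_at isCont_def tendsto_nhds_iff)

locale normalized_submanifold =
  fixes M :: "(complex^('n::finite + 'd::finite)) set" and p and \<Phi> and A :: "'d \<Rightarrow> complex^'n^'n"
    and U W S and R :: "'d \<Rightarrow> (complex^'n) \<times> (real^'d) \<Rightarrow> real" and k
  assumes herm: "\<And>j. hermitian (A j)" and \<Phi>p: "\<Phi> p = 0" and pU: "p \<in> U"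
    and bih: "biholomorphic_between \<Phi> U W"
    and S: "open S" "\<And>x. x \<in> W \<Longrightarrow> (z_part x, \<chi> i. Im (w_part x $ i)) \<in> S"
    and C2: "\<And>j. class_C_on k (R j) S" "k \<ge> 2"
    and O3: "\<And>j. R j \<in> O[nhds 0](\<lambda>(z, v). (norm z + sqrt (norm v)) ^ 3)"
    and image: "\<Phi> ` (M \<inter> U) =
          {x \<in> W. \<forall>j. of_real (Re (w_part x $ j)) - herm_form (A j) (z_part x)
                        + of_real (R j (z_part x, \<chi> i. Im (w_part x $ i))) = 0}"
begin

abbreviation "\<Psi> \<equiv> inv_into U \<Phi>"

lemmas \<Phi> = biholomorphic_betweenD[OF bih]

definition on_graph :: "complex^('n + 'd) \<Rightarrow> bool" where
  "on_graph y \<longleftrightarrow> (\<forall>j. Re (w_part y $ j) =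
    Re (sesq (A j) (z_part y) (z_part y)) - R j (z_part y, \<chi> i. Im (w_part y $ i)))"

text \<open>Hermitian forms are real on the diagonal, so the complex defining equation amounts to
  its real part; injectivity of \<open>\<Phi>\<close> on U transfers membership.\<close>

lemma in_M_iff:
  assumes "x \<in> U"
  shows "x \<in> M \<longleftrightarrow> on_graph (\<Phi> x)"
proof -
  have "Im (sesq (A j) z z) = 0" for j z
    using cnj_sesq[OF herm, of j z z] by (simp add: complex_eq_iff)
  then have "on_graph (\<Phi> x) \<longleftrightarrow> \<Phi> x \<in> \<Phi> ` (M \<inter> U)"
    using \<Phi>(5)[OF assms] unfolding image on_graph_def herm_form_sesq by (auto simp: complex_eq_iff algebra_simps)
  also have "\<dots> \<longleftrightarrow> x \<in> M"
    using inj_on_image_mem_iff[of \<Phi> U x "M \<inter> U"] inj_on_inverseI[of U \<Psi> \<Phi>] \<Phi>(7) assms by auto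
  finally show ?thesis by simp
qed

lemma zero_in_S: "0 \<in> S"
proof -
  have "(z_part (0 :: complex^('n + 'd)), \<chi> i. Im (w_part (0 :: complex^('n + 'd)) $ i)) = 0"
    by (simp add: z_part_def w_part_def vec_eq_iff zero_prod_def)
  then show ?thesis
    using S(2)[of 0] \<Phi>(5)[OF pU] \<Phi>p by simp
qed

lemma cubic: "cubic_remainder (R j) S k"
  by standard (use S zero_in_S C2 O3 in auto)

section \<open>The graph over (z, Im w) and invariance of M under inverse germs\<close>

definition chart :: "complex^('n + 'd) \<Rightarrow> (complex^'n) \<times> (real^'d)" where
  "chart y = (z_part y, \<chi> i. Im (w_part y $ i))"

text \<open>Parametrizes M in normal coordinates by points of (z, Im w)-space. This turns self-maps
  of M into maps between open sets of one Euclidean space, the setting of invariance of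
  domain.\<close>

definition graph :: "(complex^'n) \<times> (real^'d) \<Rightarrow> complex^('n + 'd)" where
  "graph s = mk (fst s)
    (\<chi> j. Complex (Re (sesq (A j) (fst s) (fst s)) - R j s) (snd s $ j))"

lemma on_graph_graph: "on_graph (graph s)"
  by (simp add: on_graph_def graph_def vec_lambda_eta)

lemma chart_graph: "chart (graph s) = s"
  by (simp add: chart_def graph_def vec_lambda_eta)

lemma graph_chart: "on_graph y \<Longrightarrow> graph (chart y) = y"
proof -
  assume "on_graph y"
  then have "(\<chi> j. Complex (Re (sesq (A j) (z_part y) (z_part y)) - R j (chart y)) (Im (w_part y $ j))) = w_part y"
    by (simp add: on_graph_def chart_def vec_eq_iff complex_eq_iff)
  then show ?thesis by (simp add: graph_def chart_def)
qed

lemma continuous_chart: "continuous_on X chart"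
  unfolding chart_def z_part_def w_part_def by (intro continuous_intros)

lemma continuous_graph: "continuous_on S graph"
proof -
  have "continuous_on S (R j)" for j
    using C2(1)[of j] unfolding class_C_on_def by (metis iterated_deriv.simps(1) le0 list.size(3))
  then show ?thesis
    unfolding graph_def Complex_eq by (intro continuous_intros) auto
qed

lemma graph_0: "graph 0 = 0"
proof -
  have "R j 0 = 0" for j by (rule cubic_remainder.R_0[OF cubic])
  then show ?thesis
    by (simp add: graph_def Complex_eq zero_vec_def[symmetric])
qed

text \<open>A germ of an automorphism restricts to an injective continuous self-map of the graph, which is
  open by invariance of domain; hence its inverse also preserves the submanifold.\<close>

lemma inverse_preserves:
  assumes G: "biholomorphic_between G UG VG" "p \<in> UG" "G p = p" "G ` (M \<inter> UG) \<subseteq> M"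
  shows "\<forall>\<^sub>F q in nhds p. q \<in> M \<longrightarrow> inv_into UG G q \<in> M"
proof -
  note G' = biholomorphic_betweenD[OF G(1)]
  have \<Psi>0: "\<Psi> 0 = p" using \<Phi>(7)[OF pU] \<Phi>p by simp
  \<comment> \<open>Successive open preimages: the graph stays in W, then its pullback in UG, then
    the image under G in U.\<close>
  define S1 where "S1 = S \<inter> graph -` W"
  have S1: "open S1" "continuous_on S1 (\<lambda>s. \<Psi> (graph s))"
  proof -
    show "open S1"
      unfolding S1_def by (rule continuous_open_preimage[OF continuous_graph S(1) \<Phi>(2)])
    show "continuous_on S1 (\<lambda>s. \<Psi> (graph s))"
      by (rule continuous_on_compose2[OF holomorphic_map_on_continuous[OF \<Phi>(4)]
            continuous_on_subset[OF continuous_graph]]) (auto simp: S1_def)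
  qed
  define S2 where "S2 = S1 \<inter> (\<lambda>s. \<Psi> (graph s)) -` UG"
  have S2: "open S2" "continuous_on S2 (\<lambda>s. G (\<Psi> (graph s)))"
  proof -
    show "open S2"
      unfolding S2_def by (rule continuous_open_preimage[OF S1(2,1) G'(1)])
    show "continuous_on S2 (\<lambda>s. G (\<Psi> (graph s)))"
      by (rule continuous_on_compose2[OF holomorphic_map_on_continuous[OF G'(3)]
            continuous_on_subset[OF S1(2)]]) (auto simp: S2_def)
  qed
  define S3 where "S3 = S2 \<inter> (\<lambda>s. G (\<Psi> (graph s))) -` U"
  define \<theta> where "\<theta> s = chart (\<Phi> (G (\<Psi> (graph s))))" for s
  have S3: "open S3" "continuous_on S3 \<theta>"
  proof -
    show "open S3"
      unfolding S3_def by (rule continuous_open_preimage[OF S2(2,1) \<Phi>(1)])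
    have "continuous_on S3 (\<lambda>s. \<Phi> (G (\<Psi> (graph s))))"
      by (rule continuous_on_compose2[OF holomorphic_map_on_continuous[OF \<Phi>(3)]
            continuous_on_subset[OF S2(2)]]) (auto simp: S3_def)
    then show "continuous_on S3 \<theta>"
      unfolding \<theta>_def by (rule continuous_on_compose2[OF continuous_chart[of UNIV]]) auto
  qed
  have in_S3: "graph s \<in> W" "\<Psi> (graph s) \<in> U" "\<Psi> (graph s) \<in> UG" "G (\<Psi> (graph s)) \<in> U"
    "\<Psi> (graph s) \<in> M" "G (\<Psi> (graph s)) \<in> M" if "s \<in> S3" for s
  proof -
    show 1: "graph s \<in> W" "\<Psi> (graph s) \<in> UG" "G (\<Psi> (graph s)) \<in> U"
      using that by (auto simp: S3_def S2_def S1_def)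
    show 2: "\<Psi> (graph s) \<in> U" by (rule \<Phi>(6)[OF 1(1)])
    then show "\<Psi> (graph s) \<in> M"
      using in_M_iff \<Phi>(8)[OF 1(1)] on_graph_graph by simp
    then show "G (\<Psi> (graph s)) \<in> M" using G(4) 1(2) by blast
  qed
  have chart_eq: "\<Phi> x = \<Phi> y" if "chart (\<Phi> x) = chart (\<Phi> y)" "x \<in> M" "y \<in> M" "x \<in> U" "y \<in> U" for x y
    using that in_M_iff graph_chart by metis
  have inj: "inj_on \<theta> S3"
  proof (rule inj_onI)
    fix s t assume st: "s \<in> S3" "t \<in> S3" "\<theta> s = \<theta> t"
    then have "\<Phi> (G (\<Psi> (graph s))) = \<Phi> (G (\<Psi> (graph t)))"
      unfolding \<theta>_def by (intro chart_eq in_S3)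
    then have "G (\<Psi> (graph s)) = G (\<Psi> (graph t))"
      using \<Phi>(7) in_S3(4) st by metis
    then have "\<Psi> (graph s) = \<Psi> (graph t)"
      using G'(7) in_S3(3) st by metis
    then have "graph s = graph t"
      using \<Phi>(8) in_S3(1) st by metis
    then show "s = t" using chart_graph by metis
  qed
  have op: "open (\<theta> ` S3)"
    by (rule invariance_of_domain[OF S3(2,1) inj])
  have "0 \<in> S3"
    using zero_in_S graph_0 \<Psi>0 G(2,3) pU \<Phi>(5)[OF pU] \<Phi>p by (auto simp: S3_def S2_def S1_def)
  moreover have "\<theta> 0 = chart 0"
    by (simp add: \<theta>_def graph_0 \<Psi>0 G(3) \<Phi>p)
  ultimately have c0: "chart (\<Phi> p) \<in> \<theta> ` S3" using \<Phi>p by (metis image_eqI)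
  \<comment> \<open>The chart of a point q of M in N is that of G x for some x in M; points of M
    with equal charts coincide, so q = G x.\<close>
  define N where "N = U \<inter> (\<lambda>q. chart (\<Phi> q)) -` (\<theta> ` S3)"
  have "continuous_on U (\<lambda>q. chart (\<Phi> q))"
    by (rule continuous_on_compose2[OF continuous_chart[of UNIV] holomorphic_map_on_continuous[OF \<Phi>(3)]]) auto
  then have "open N"
    unfolding N_def by (rule continuous_open_preimage[OF _ \<Phi>(1) op])
  moreover have "p \<in> N" using c0 pU by (simp add: N_def)
  ultimately have "\<forall>\<^sub>F q in nhds p. q \<in> N" by (rule eventually_nhds_in_open)
  then show ?thesis
  proof eventually_elim
    case (elim q)
    show ?case
    proof
      assume "q \<in> M"
      obtain s where s: "s \<in> S3" "chart (\<Phi> q) = \<theta> s" and "q \<in> U"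
        using elim by (auto simp: N_def)
      have "\<Phi> q = \<Phi> (G (\<Psi> (graph s)))"
        using s \<open>q \<in> M\<close> \<open>q \<in> U\<close> unfolding \<theta>_def by (intro chart_eq in_S3)
      then have "q = G (\<Psi> (graph s))"
        using \<Phi>(7) \<open>q \<in> U\<close> in_S3(4)[OF s(1)] by metis
      then show "inv_into UG G q \<in> M"
        using G'(7) in_S3(3,5)[OF s(1)] by simp
    qed
  qed
qed

text \<open>The map H is \<open>\<Phi>\<close> after the inverse of G after F after
  \<open>\<Psi>\<close>. It is split into K after E, since cubic contact compares E with G after
  \<open>\<Psi>\<close> under the Lipschitz map K.\<close>

lemma germs_agree:
  assumes F: "biholomorphic_between F UF VF" "p \<in> UF" "F p = p" "F ` (M \<inter> UF) \<subseteq> M"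
    and G: "biholomorphic_between G UG VG" "p \<in> UG" "G p = p" "G ` (M \<inter> UG) \<subseteq> M"
    and jet: "same_jet 2 F G p"
    and kernel: "\<And>v. (\<And>j. A j *v v = 0) \<Longrightarrow> v = 0"
    and ind: "\<And>c. (\<Sum>j\<in>UNIV. c j *s (A j *v V0)) = 0 \<Longrightarrow> \<forall>j. c j = 0"
  shows "\<forall>\<^sub>F x in nhds p. F x = G x"
proof -
  note F' = biholomorphic_betweenD[OF F(1)] and G' = biholomorphic_betweenD[OF G(1)]
  let ?G' = "inv_into UG G"
  have \<Psi>0: "\<Psi> 0 = p" using \<Phi>(7)[OF pU] \<Phi>p by simp
  have W0: "0 \<in> W" using \<Phi>(5)[OF pU] \<Phi>p by simp
  have G'p: "?G' p = p" "p \<in> VG" using G'(5,7)[OF G(2)] G(3) by auto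

  define V1 where "V1 = VG \<inter> ?G' -` U"
  define K where "K q = \<Phi> (?G' q)" for q
  have V1: "open V1" "p \<in> V1"
    unfolding V1_def using continuous_open_preimage[OF holomorphic_map_on_continuous[OF G'(4)] G'(2) \<Phi>(1)]
      G'p pU by auto
  have K: "holomorphic_map_on K V1"
    unfolding K_def by (rule holomorphic_map_on_compose[OF holomorphic_map_on_subset[OF G'(4)] \<Phi>(3)])
      (auto simp: V1_def)

  define W1 where "W1 = W \<inter> \<Psi> -` UF"
  define E where "E y = F (\<Psi> y)" for y
  have W1: "open W1" "0 \<in> W1"
    unfolding W1_def using continuous_open_preimage[OF holomorphic_map_on_continuous[OF \<Phi>(4)] \<Phi>(2) F'(1)]
      W0 \<Psi>0 F(2) by auto
  have E: "holomorphic_map_on E W1"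
    unfolding E_def by (rule holomorphic_map_on_compose[OF holomorphic_map_on_subset[OF \<Phi>(4)] F'(3)])
      (auto simp: W1_def)
  have E0: "E 0 = p" by (simp add: E_def \<Psi>0 F(3))

  define W2 where "W2 = W1 \<inter> E -` V1"
  define H where "H y = K (E y)" for y
  have W2: "open W2" "0 \<in> W2"
    unfolding W2_def using continuous_open_preimage[OF holomorphic_map_on_continuous[OF E] W1(1) V1(1)]
      W1(2) E0 V1(2) by auto
  have H: "holomorphic_map_on H W2"
    unfolding H_def by (rule holomorphic_map_on_compose[OF holomorphic_map_on_subset[OF E] K])
      (auto simp: W2_def)

  have \<Psi>_lim: "(\<Psi> \<longlongrightarrow> p) (nhds 0)"
    using holomorphic_map_on_tendsto[OF \<Phi>(4) \<Phi>(2) W0] by (simp add: \<Psi>0)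
  have E_lim: "(E \<longlongrightarrow> p) (nhds 0)"
    using holomorphic_map_on_tendsto[OF E W1] by (simp add: E0)

  have cubic_contact: "\<exists>C\<ge>0. \<forall>\<^sub>F y in nhds 0. norm (H y - y) \<le> C * norm y ^ 3"
  proof -
    have "open (UF \<inter> UG)" "p \<in> UF \<inter> UG" using F'(1) G'(1) F(2) G(2) by auto
    then obtain r1 C1 where 1: "r1 > 0" "C1 \<ge> 0"
      "\<And>x. x \<in> ball p r1 \<Longrightarrow> norm (F x - G x) \<le> C1 * norm (x - p) ^ 3"
      using same_jet_2_imp_cubic_contact[OF holomorphic_map_on_subset[OF F'(3)]
          holomorphic_map_on_subset[OF G'(3)] _ _ jet] by (metis inf_le1 inf_le2)
    obtain r2 L2 where 2: "r2 > 0" "L2 \<ge> 0"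
      "\<And>x y. x \<in> ball p r2 \<Longrightarrow> y \<in> ball p r2 \<Longrightarrow> norm (K x - K y) \<le> L2 * norm (x - y)"
      using holomorphic_map_Lipschitz[OF K V1] by metis
    obtain r3 L3 where 3: "r3 > 0" "L3 \<ge> 0"
      "\<And>x y. x \<in> ball 0 r3 \<Longrightarrow> y \<in> ball 0 r3 \<Longrightarrow> norm (\<Psi> x - \<Psi> y) \<le> L3 * norm (x - y)"
      using holomorphic_map_Lipschitz[OF \<Phi>(4) \<Phi>(2) W0] by metis
    have "(G \<longlongrightarrow> p) (nhds p)"
      using holomorphic_map_on_tendsto[OF G'(3) G'(1) G(2)] by (simp add: G(3))
    then have "((\<lambda>y. G (\<Psi> y)) \<longlongrightarrow> p) (nhds 0)"
      using \<Psi>_lim by (rule filterlim_compose)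
    then have "\<forall>\<^sub>F y in nhds 0. G (\<Psi> y) \<in> ball p r2"
      by (rule topological_tendstoD) (use 2 in auto)
    moreover have "\<forall>\<^sub>F y in nhds 0. E y \<in> ball p r2"
      by (rule topological_tendstoD[OF E_lim]) (use 2 in auto)
    moreover have "\<forall>\<^sub>F y in nhds 0. \<Psi> y \<in> ball p r1 \<inter> UG"
      by (rule topological_tendstoD[OF \<Psi>_lim]) (use 1 G'(1) G(2) in auto)
    moreover have "\<forall>\<^sub>F y in nhds 0. y \<in> ball 0 r3 \<inter> W"
      by (rule eventually_nhds_in_open) (use 3 \<Phi>(2) W0 in auto)
    ultimately have "\<forall>\<^sub>F y in nhds 0. norm (H y - y) \<le> (L2 * (C1 * L3 ^ 3)) * norm y ^ 3"
    proof eventually_elim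
      case (elim y)
      \<comment> \<open>This makes H y - y an increment of K, bounded through the contact of F and G
        at \<open>\<Psi> y\<close>.\<close>
      have "K (G (\<Psi> y)) = y"
        using elim \<Phi>(8) G'(7) by (simp add: K_def)
      then have "norm (H y - y) \<le> L2 * norm (E y - G (\<Psi> y))"
        using 2(3)[of "E y" "G (\<Psi> y)"] elim by (simp add: H_def)
      also have "\<dots> \<le> L2 * (C1 * norm (\<Psi> y - p) ^ 3)"
        unfolding E_def using elim by (intro mult_left_mono 1 2) auto
      also have "\<dots> \<le> L2 * (C1 * (L3 * norm y) ^ 3)"
        using 3(3)[of y 0] 3(1) elim by (intro mult_left_mono power_mono 1 2) (auto simp: \<Psi>0)
      finally show ?case
        by (simp add: power_mult_distrib mult_ac)
    qed
    moreover have "L2 * (C1 * L3 ^ 3) \<ge> 0" using 1 2 3 by simp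
    ultimately show ?thesis by blast
  qed
  have preserves: "\<forall>\<^sub>F y in nhds 0. on_graph y \<longrightarrow> on_graph (H y)"
  proof -
    have "\<forall>\<^sub>F y in nhds 0. E y \<in> M \<longrightarrow> ?G' (E y) \<in> M"
      using eventually_compose_filterlim[OF inverse_preserves[OF G] E_lim] .
    moreover have "\<forall>\<^sub>F y in nhds 0. y \<in> W2"
      by (rule eventually_nhds_in_open[OF W2])
    ultimately show ?thesis
    proof eventually_elim
      case (elim y)
      then have y: "y \<in> W" "\<Psi> y \<in> UF" "E y \<in> VG" "?G' (E y) \<in> U"
        by (auto simp: W2_def W1_def V1_def)
      show ?case
      proof
        assume "on_graph y"
        then have "\<Psi> y \<in> M"
          using in_M_iff[OF \<Phi>(6)[OF y(1)]] \<Phi>(8)[OF y(1)] by simp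
        then have "E y \<in> M"
          unfolding E_def using F(4) y(2) by blast
        then show "on_graph (H y)"
          using elim in_M_iff[OF y(4)] by (simp add: H_def K_def)
      qed
    qed
  qed
  define h where "h c y = H y $ c - y $ c" for c y
  have id: "holomorphic_map_on (\<lambda>y. y) W2"
    unfolding holomorphic_map_on_def
    by (auto intro!: exI[of _ "\<lambda>v. v"] simp: Vector_Spaces.linear_iff vec.vector_space_axioms)
  have h: "holo (h c) W2" for c
    unfolding h_def[abs_def] by (intro holo_diff holo_component H id)
  obtain C where C: "C \<ge> 0" "\<forall>\<^sub>F y in nhds 0. norm (H y - y) \<le> C * norm y ^ 3"
    using cubic_contact by blast
  have "\<forall>\<^sub>F y in nhds 0. norm (H y - y) \<le> C * norm y ^ 3 \<and> (on_graph y \<longrightarrow> on_graph (H y)) \<and> y \<in> W2"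
    by (intro eventually_conj C preserves eventually_nhds_in_open W2)
  then obtain r where r: "r > 0" "\<And>y. norm y < r \<Longrightarrow>
      norm (H y - y) \<le> C * norm y ^ 3 \<and> (on_graph y \<longrightarrow> on_graph (H y)) \<and> y \<in> W2"
    unfolding eventually_nhds_metric by auto
  have h3: "norm (h c y) \<le> C * norm y ^ 3" if "y \<in> ball 0 r" for c y
  proof -
    have "norm (h c y) \<le> norm (H y - y)"
      using Finite_Cartesian_Product.norm_nth_le[of "H y - y" c] by (simp add: h_def)
    then show ?thesis using r(2)[of y] that by auto
  qed
  interpret normal_form_map A R S k h r "C * r ^ 3" C r
  proof (rule normal_form_map.intro)
    show "bounded_holo wgt (h c) r (C * r ^ 3)" for c
    proof
      show "wgt i \<ge> 1" for i :: "'n + 'd" by (auto simp: wgt_def split: sum.split)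
      show "holo (h c) (ball 0 r)"
        by (rule holo_subset[OF h]) (use r in auto)
      show "norm (h c x) \<le> C * r ^ 3" if "x \<in> ball 0 r" for x
        using h3[OF that, where c = c] that C(1)
        by (smt (verit) mem_ball_0 mult_left_mono norm_ge_zero power_mono)
    qed (use r in auto)
    fix y y' j
    assume y: "norm y < r" "\<And>j. Re (w_part y $ j) =
      Re (sesq (A j) (z_part y) (z_part y)) - R j (z_part y, \<chi> i. Im (w_part y $ i))"
      and y': "y' = y + (\<chi> c. h c y)"
    have "on_graph y" using y(2) by (simp add: on_graph_def)
    then have "on_graph (H y)" using r(2)[OF y(1)] by blast
    moreover have "y' = H y" by (simp add: y' h_def vec_eq_iff)
    ultimately show "Re (w_part y' $ j) =
      Re (sesq (A j) (z_part y') (z_part y')) - R j (z_part y', \<chi> i. Im (w_part y' $ i))"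
      by (simp add: on_graph_def)
  qed (use herm cubic h3 r in auto)
  have "\<forall>\<^sub>F y in nhds 0. \<forall>c. h c y = 0"
    by (intro eventually_all_finite eventually_0[OF kernel ind])
  then have H_id: "\<forall>\<^sub>F y in nhds 0. H y = y"
    by eventually_elim (simp add: h_def vec_eq_iff)
  have "(\<Phi> \<longlongrightarrow> 0) (nhds p)"
    using holomorphic_map_on_tendsto[OF \<Phi>(3) \<Phi>(1) pU] by (simp add: \<Phi>p)
  note ev = eventually_compose_filterlim[OF _ this]
  from ev[OF H_id] ev[OF eventually_nhds_in_open[OF W2]] eventually_nhds_in_open[OF \<Phi>(1) pU]
  show ?thesis
  proof eventually_elim
    case (elim x)
    have x: "\<Psi> (\<Phi> x) = x" by (rule \<Phi>(7)[OF elim(3)])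
    have Fx: "F x \<in> VG" "?G' (F x) \<in> U"
      using elim(2) by (auto simp: W2_def W1_def V1_def E_def x)
    have "\<Phi> (?G' (F x)) = \<Phi> x"
      using elim(1) by (simp add: H_def K_def E_def x)
    then have "?G' (F x) = x"
      using \<Phi>(7) Fx(2) elim(3) by metis
    then show ?case
      using G'(8)[OF Fx(1)] by simp
  qed
qed

end

section \<open>Linear algebra of the non-degeneracy conditions, and the conclusion\<close>

text \<open>Dimension d forces the d vectors to be pairwise distinct, since a repetition would leave
  fewer than d spanning elements. Independence of their set is then independence of the indexed
  family.\<close>

lemma independent_if_dim_eq_card:
  fixes b :: "'d::finite \<Rightarrow> complex^'n"
  assumes "vec.dim (vec.span (range b)) = CARD('d)" "(\<Sum>j\<in>UNIV. c j *s b j) = 0"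
  shows "\<forall>j. c j = 0"
proof -
  have dim: "vec.dim (range b) = CARD('d)"
    using assms(1) by (simp add: vec.dim_span)
  have le: "vec.dim (range b) \<le> card (range b)"
    by (rule vec.dim_le_card') simp
  then have card: "card (range b) = CARD('d)"
    using dim card_image_le[of UNIV b] by simp
  then have inj: "inj b"
    by (simp add: eq_card_imp_inj_on)
  have ind: "vec.independent (range b)"
    by (rule vec.card_le_dim_spanning[of _ "range b"]) (auto simp: dim card vec.span_superset)
  define u where "u v = c (inv b v)" for v
  have "(\<Sum>v\<in>range b. u v *s v) = 0"
    using assms(2) by (simp add: sum.reindex[OF inj] u_def inj o_def)
  then have "u v = 0" if "v \<in> range b" for v
    using vec.independentD[OF ind finite_imageI[OF finite] subset_refl, of u v] that by simp
  then have "c j = 0" for j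
    using inj by (metis inv_f_f rangeI u_def)
  then show ?thesis by blast
qed

text \<open>A common kernel vector is killed by every combination, in particular by an invertible
  one. Condition (t) enters the disc argument in this form.\<close>

lemma common_kernel_trivial:
  fixes A :: "'d::finite \<Rightarrow> complex^'n^'n" and c :: "'d \<Rightarrow> real"
  assumes "invertible (\<Sum>j\<in>UNIV. c j *\<^sub>R A j)" "\<And>j. A j *v v = 0"
  shows "v = 0"
proof -
  let ?B = "\<Sum>j\<in>UNIV. c j *\<^sub>R A j"
  have "(?B *v v) $ i = (\<Sum>j\<in>UNIV. c j *\<^sub>R (A j *v v) $ i)" for i
    by (simp add: matrix_vector_mult_def sum_distrib_right scaleR_sum_right) (rule sum.swap)
  then have "?B *v v = 0"
    by (simp add: assms(2) vec_eq_iff)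
  moreover obtain B' where "B' ** ?B = mat 1"
    using assms(1) by (auto simp: invertible_def)
  ultimately show ?thesis
    by (metis matrix_vector_mul_assoc matrix_vector_mul_lid matrix_vector_mult_0_right)
qed

theorem corollary0p4:
  fixes M :: "(complex^('n::finite + 'd::finite)) set"
    and p :: "complex^('n + 'd)"
    and F G :: "complex^('n + 'd) \<Rightarrow> complex^('n + 'd)"
  assumes "generic_submanifold 4 CARD('d) M"
    and "p \<in> M"
    and "fully_nondegenerate 4 M p"
    and "F \<in> Aut_germs M p"
    and "G \<in> Aut_germs M p"
    and "same_jet 2 F G p"
  shows "\<forall>\<^sub>F x in nhds p. F x = G x"
proof -
  obtain \<Phi> A V0 and c :: "'d \<Rightarrow> real" where norm: "normalizing_coordinates 4 M p \<Phi> A"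
    and f: "vec.dim (vec.span (range (\<lambda>j. A j *v V0))) = CARD('d)"
    and t: "invertible (\<Sum>j\<in>UNIV. c j *\<^sub>R A j)"
    using assms(3) unfolding fully_nondegenerate_def by blast
  obtain UF VF where F: "biholomorphic_between F UF VF" "p \<in> UF" "F p = p" "F ` (M \<inter> UF) \<subseteq> M"
    using assms(4) unfolding Aut_germs_def by blast
  obtain UG VG where G: "biholomorphic_between G UG VG" "p \<in> UG" "G p = p" "G ` (M \<inter> UG) \<subseteq> M"
    using assms(5) unfolding Aut_germs_def by blast
  have "\<exists>U W S R. normalized_submanifold M p \<Phi> A U W S R 4"
    using norm unfolding normalizing_coordinates_def normalized_submanifold_def
    by (elim conjE exE) (intro exI conjI; (assumption | simp))
  then obtain U W S R where "normalized_submanifold M p \<Phi> A U W S R 4"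
    by blast
  then show ?thesis
    by (rule normalized_submanifold.germs_agree[OF _ F G assms(6)
          common_kernel_trivial[OF t] independent_if_dim_eq_card[OF f]])
qed

end
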